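(* There exists a universal constant $C>0$ such that for every integer $n\geq 1$ and every non-empty origin-symmetric convex body $K\subseteq\mathbb{R}^n$ the following holds. There exists a basis $\mathbf{b}_1,\dots,\mathbf{b}_n$ of the lattice $\mathbb{Z}^n$ such that $$\#(K)^{\frac{n-1}{n}} < C\,n^2\,2^n \Big(\prod_{i=1}^n \#(K\cap \mathbf{b}_i^\perp)\Big)^{\frac1n},$$ and there exist $\mathbf{t}_1,\dots,\mathbf{t}_n\in\mathbb{Z}^n$ such that (with the same basis) $$\#(K)^{\frac{n-1}{n}} < C\,n^2 \Big(\prod_{i=1}^n \#\big(K\cap (\mathbf{t}_i+\mathbf{b}_i^\perp)\big)\Big)^{\frac1n}.$$
   Context: A convex body in $\mathbb{R}^n$ is a compact convex set (not necessarily with non-empty interior); it is origin-symmetric if $K=-K$. For $M\subseteq\mathbb{R}^n$, $\#(M)=|M\cap\mathbb{Z}^n|$ is the number of integer points in $M$. A basis of the lattice $\mathbb{Z}^n$ is a set of $n$ vectors of $\mathbb{Z}^n$ whose integer linear combinations are all of $\mathbb{Z}^n$. For $\mathbf{b}\neq \mathbf 0$, $\mathbf{b}^\perp=\{\mathbf{x}\in\mathbb{R}^n:\langle\mathbf{x},\mathbf{b}\rangle=0\}$. *)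

theory Defs
  imports "HOL-Analysis.Analysis"
begin

(* The constant in the theorem is uniform in the dimension n, so n has to be a term and not a
   type.  Points of R^n are those of the library's "Euclidean_space n": functions nat => real
   vanishing at all indices i >= n, with the product topology, which here is the usual topology
   of R^n. *)

abbreviation Rn :: "nat \<Rightarrow> (nat \<Rightarrow> real) set" where
  "Rn n \<equiv> topspace (Euclidean_space n)"

definition Zn :: "nat \<Rightarrow> (nat \<Rightarrow> real) set" where
  "Zn n = {x \<in> Rn n. \<forall>i. x i \<in> \<int>}"

(* Function types are not an instance of real_vector, so convexity is spelled out; it is the
   library's convex with the linear operations taken pointwise. *)
definition convex_fun :: "(nat \<Rightarrow> real) set \<Rightarrow> bool" where
  "convex_fun K \<longleftrightarrow>
     (\<forall>x\<in>K. \<forall>y\<in>K. \<forall>u\<ge>0. \<forall>v\<ge>0. u + v = 1 \<longrightarrow> (\<lambda>i. u * x i + v * y i) \<in> K)"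

(* compactin includes K \<subseteq> Rn n *)
definition convex_body :: "nat \<Rightarrow> (nat \<Rightarrow> real) set \<Rightarrow> bool" where
  "convex_body n K \<longleftrightarrow> compactin (Euclidean_space n) K \<and> convex_fun K"

definition origin_symmetric :: "(nat \<Rightarrow> real) set \<Rightarrow> bool" where
  "origin_symmetric K \<longleftrightarrow> K = (\<lambda>x i. - x i) ` K"

(* Only used for subsets M of compact sets, where M \<inter> Zn n is finite, so that card is the true
   number of integer points. *)
definition num_int_points :: "nat \<Rightarrow> (nat \<Rightarrow> real) set \<Rightarrow> nat" where
  "num_int_points n M = card (M \<inter> Zn n)"

definition lattice_basis :: "nat \<Rightarrow> (nat \<Rightarrow> nat \<Rightarrow> real) \<Rightarrow> bool" where
  "lattice_basis n b \<longleftrightarrow>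
     inj_on b {..<n} \<and> b ` {..<n} \<subseteq> Zn n \<and>
     range (\<lambda>(c :: nat \<Rightarrow> int) j. \<Sum>i<n. of_int (c i) * b i j) = Zn n"

definition orth :: "nat \<Rightarrow> (nat \<Rightarrow> real) \<Rightarrow> (nat \<Rightarrow> real) set" where
  "orth n b = {x \<in> Rn n. (\<Sum>i<n. x i * b i) = 0}"

definition translate :: "(nat \<Rightarrow> real) \<Rightarrow> (nat \<Rightarrow> real) set \<Rightarrow> (nat \<Rightarrow> real) set" where
  "translate t S = (\<lambda>x i. t i + x i) ` S"

end

theory Submission
  imports Defs "Jordan_Normal_Form.Determinant"
begin

text \<open>
  If all integer points \<open>s\<close> of \<open>K\<close> satisfy \<open>\<bar>\<langle>s, b\<^sub>i\<rangle>\<bar> \<le> r\<^sub>i\<close>, then some translate of \<open>b\<^sub>i\<^sup>\<bottom>\<close> contains at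
  least \<open>#(K) / (2 \<lfloor>r\<^sub>i\<rfloor> + 1)\<close> of them. So it suffices to find a basis with
  \<open>\<Prod>\<^sub>i (2 \<lfloor>r\<^sub>i\<rfloor> + 1) \<le> (3 n\<^sup>2)\<^sup>n #(K)\<close>; passing from a slice to the central one costs a factor \<open>2\<^sup>n\<close>.

  A D-optimal design on the integer points gives a quadratic form \<open>q\<close> with
  \<open>\<langle>s, v\<rangle>\<^sup>2 \<le> n q(v)\<close> such that \<open>K\<close> contains all integer points of the ellipsoid polar to \<open>q \<le> 1\<close>.
  Let \<open>b\<close> be a Hermite--Korkine--Zolotarev reduced basis for \<open>q\<close>, with Gram--Schmidt
  lengths \<open>\<alpha>\<^sub>i\<close> and running maxima \<open>m\<^sub>i\<close>. Then \<open>q(b\<^sub>i) \<le> n m\<^sub>i\<^sup>2\<close>, so \<open>r\<^sub>i = n m\<^sub>i\<close> works, and the factors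
  with \<open>n m\<^sub>i < 1\<close> are equal to 1. On the remaining indices \<open>i \<ge> k\<close> Minkowski's linear form theorem
  is applied twice: the box with half-widths \<open>m\<^sub>i / \<surd>n\<close> contains no nonzero lattice vector, hence
  \<open>\<Prod> m\<^sub>i \<le> \<Prod> \<surd>n \<alpha>\<^sub>i\<close>, and the dual box with half-widths \<open>1 / \<surd>n\<close> lies in the ellipsoid, hence
  \<open>\<Prod> \<alpha>\<^sub>i / \<surd>n \<le> #(K)\<close>. Each of the two steps loses a factor \<open>\<surd>n\<close> per index.
\<close>

section \<open>D-optimal designs\<close>

definition dot :: "nat \<Rightarrow> (nat \<Rightarrow> real) \<Rightarrow> (nat \<Rightarrow> real) \<Rightarrow> real" where
  "dot n x y = (\<Sum>i<n. x i * y i)"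

text \<open>The matrix determinant lemma. \<open>?P\<close> is unit block lower triangular and
  \<open>?P * ?Q = ?R * ?P\<close>, so the block upper triangular matrices \<open>?Q\<close> and
  \<open>?R\<close> have equal determinants.\<close>

lemma det_one_plus_outer:
  fixes u v :: "real Matrix.mat"
  assumes u: "u \<in> carrier_mat n 1" and v: "v \<in> carrier_mat 1 n"
  shows "Determinant.det (1\<^sub>m n + u * v) = 1 + (v * u) $$ (0,0)"
proof -
  let ?I = "1\<^sub>m n :: real Matrix.mat" and ?J = "1\<^sub>m 1 :: real Matrix.mat"
  let ?P = "four_block_mat ?I (0\<^sub>m n 1) v ?J"
  let ?Q = "four_block_mat (?I + u * v) u (0\<^sub>m 1 n) ?J"
  let ?R = "four_block_mat ?I u (0\<^sub>m 1 n) (?J + v * u)"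
  have uv: "u * v \<in> carrier_mat n n" and vu: "v * u \<in> carrier_mat 1 1"
    using u v by auto
  have "?P * ?Q = four_block_mat (?I * (?I + u * v) + 0\<^sub>m n 1 * 0\<^sub>m 1 n) (?I * u + 0\<^sub>m n 1 * ?J)
          (v * (?I + u * v) + ?J * 0\<^sub>m 1 n) (v * u + ?J * ?J)"
    by (rule mult_four_block_mat) (use u v uv in auto)
  moreover have "?R * ?P = four_block_mat (?I * ?I + u * v) (?I * 0\<^sub>m n 1 + u * ?J)
          (0\<^sub>m 1 n * ?I + (?J + v * u) * v) (0\<^sub>m 1 n * 0\<^sub>m n 1 + (?J + v * u) * ?J)"
    by (rule mult_four_block_mat) (use u v vu in auto)
  moreover have "v * (?I + u * v) + ?J * 0\<^sub>m 1 n = 0\<^sub>m 1 n * ?I + (?J + v * u) * v"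
  proof -
    have vuv: "v * u * v \<in> carrier_mat 1 n" using u v by auto
    have "v * (?I + u * v) + ?J * 0\<^sub>m 1 n = v + v * u * v"
      unfolding mult_add_distrib_mat[OF v one_carrier_mat uv] right_mult_one_mat[OF v]
        assoc_mult_mat[OF v u v, symmetric] left_mult_one_mat[OF zero_carrier_mat]
      by (rule right_add_zero_mat[OF add_carrier_mat[OF vuv]])
    moreover have "0\<^sub>m 1 n * ?I + (?J + v * u) * v = v + v * u * v"
      unfolding add_mult_distrib_mat[OF one_carrier_mat vu v] left_mult_one_mat[OF v]
        right_mult_one_mat[OF zero_carrier_mat]
      by (rule left_add_zero_mat[OF add_carrier_mat[OF vuv]])
    ultimately show ?thesis by (simp only:)
  qed
  moreover have "?I * (?I + u * v) + 0\<^sub>m n 1 * 0\<^sub>m 1 n = ?I * ?I + u * v"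
    unfolding left_mult_one_mat[OF add_carrier_mat[OF uv]] left_mult_one_mat[OF one_carrier_mat]
      left_mult_zero_mat[OF zero_carrier_mat]
    by (rule right_add_zero_mat[OF add_carrier_mat[OF uv]])
  moreover have "?I * u + 0\<^sub>m n 1 * ?J = ?I * 0\<^sub>m n 1 + u * ?J"
    using u by simp
  moreover have "v * u + ?J * ?J = 0\<^sub>m 1 n * 0\<^sub>m n 1 + (?J + v * u) * ?J"
    unfolding right_mult_one_mat[OF add_carrier_mat[OF vu]] right_mult_one_mat[OF one_carrier_mat]
      left_mult_zero_mat[OF zero_carrier_mat] comm_add_mat[OF vu one_carrier_mat]
    by (rule left_add_zero_mat[OF add_carrier_mat[OF vu], symmetric])
  ultimately have PQ: "?P * ?Q = ?R * ?P" by (simp only:)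
  have P: "?P \<in> carrier_mat (n+1) (n+1)" and Q: "?Q \<in> carrier_mat (n+1) (n+1)"
    and R: "?R \<in> carrier_mat (n+1) (n+1)"
    using u v uv vu by (auto intro!: four_block_carrier_mat)
  have "Determinant.det ?P * Determinant.det ?Q = Determinant.det ?R * Determinant.det ?P"
    using arg_cong[OF PQ, of Determinant.det] unfolding det_mult[OF P Q] det_mult[OF R P] .
  moreover have "Determinant.det ?P = 1"
    using det_four_block_mat_upper_right_zero[OF one_carrier_mat refl v one_carrier_mat] by simp
  moreover have "Determinant.det ?Q = Determinant.det (?I + u * v)"
    using det_four_block_mat_lower_left_zero[OF _ u refl one_carrier_mat, of "?I + u * v"] uv by simp
  moreover have "Determinant.det ?R = Determinant.det (?J + v * u)"
    using det_four_block_mat_lower_left_zero[OF one_carrier_mat u refl, of "?J + v * u"] vu by simp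
  moreover have "Determinant.det (?J + v * u) = 1 + (v * u) $$ (0,0)"
    using vu carrier_matD[OF vu] by (subst det_single) (auto simp del: One_nat_def)
  ultimately show ?thesis by simp
qed

text \<open>If \<open>w\<close> solves \<open>A w = s\<close>, the updated matrix factors as
  \<open>A (1 + w (t s)^T)\<close>, and the matrix determinant lemma applies to the second
  factor.\<close>

lemma det_rank_one_update:
  fixes a :: "nat \<Rightarrow> nat \<Rightarrow> real"
  assumes w: "\<And>i. i < n \<Longrightarrow> (\<Sum>j<n. a i j * w j) = s i"
  shows "Determinant.det (Matrix.mat n n (\<lambda>(i,j). a i j + t * s i * s j)) =
    Determinant.det (Matrix.mat n n (\<lambda>(i,j). a i j)) * (1 + t * dot n s w)"
proof -
  let ?A = "Matrix.mat n n (\<lambda>(i,j). a i j)"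
  let ?u = "Matrix.mat n 1 (\<lambda>(i,j). w i)" and ?v = "Matrix.mat 1 n (\<lambda>(i,j). t * s j)"
  have A: "?A \<in> carrier_mat n n" and u: "?u \<in> carrier_mat n 1" and v: "?v \<in> carrier_mat 1 n"
    by auto
  have uv: "?u * ?v \<in> carrier_mat n n" by auto
  have "Matrix.mat n n (\<lambda>(i,j). a i j + t * s i * s j) = ?A + ?A * ?u * ?v"
    by (rule eq_matI) (auto simp: scalar_prod_def w lessThan_atLeast0[symmetric])
  also have "\<dots> = ?A * (1\<^sub>m n + ?u * ?v)"
    using mult_add_distrib_mat[OF A one_carrier_mat uv] assoc_mult_mat[OF A u v] by simp
  finally have "Determinant.det (Matrix.mat n n (\<lambda>(i,j). a i j + t * s i * s j)) =
    Determinant.det ?A * Determinant.det (1\<^sub>m n + ?u * ?v)"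
    using det_mult[OF A add_carrier_mat[OF uv, of "1\<^sub>m n"]] by simp
  moreover have "(?v * ?u) $$ (0,0) = t * dot n s w"
    by (auto simp: scalar_prod_def dot_def sum_distrib_left lessThan_atLeast0 mult_ac)
  ultimately show ?thesis
    using det_one_plus_outer[OF u v] by simp
qed

lemma det_nonzero_iff_injective:
  fixes a :: "nat \<Rightarrow> nat \<Rightarrow> real"
  shows "Determinant.det (Matrix.mat n n (\<lambda>(i,j). a i j)) \<noteq> 0 \<longleftrightarrow>
    (\<forall>w. (\<forall>i<n. (\<Sum>j<n. a i j * w j) = 0) \<longrightarrow> (\<forall>i<n. w i = 0))"
proof -
  let ?A = "Matrix.mat n n (\<lambda>(i,j). a i j)"
  have A: "?A \<in> carrier_mat n n" by auto
  have *: "?A *\<^sub>v Matrix.vec n w = 0\<^sub>v n \<longleftrightarrow> (\<forall>i<n. (\<Sum>j<n. a i j * w j) = 0)" for w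
    by (auto simp: vec_eq_iff scalar_prod_def lessThan_atLeast0)
  have **: "Matrix.vec n w = 0\<^sub>v n \<longleftrightarrow> (\<forall>i<n. w i = 0)" for w :: "nat \<Rightarrow> real"
    by (auto simp: vec_eq_iff)
  have ex: "(\<exists>v. v \<in> carrier_vec n \<and> P v) \<longleftrightarrow> (\<exists>w. P (Matrix.vec n w))" for P :: "real Matrix.vec \<Rightarrow> bool"
  proof
    assume "\<exists>v. v \<in> carrier_vec n \<and> P v"
    then obtain v where v: "v \<in> carrier_vec n" "P v" by blast
    then have "Matrix.vec n (vec_index v) = v" by auto
    then show "\<exists>w. P (Matrix.vec n w)" using v by metis
  qed (use vec_carrier in blast)
  show ?thesis
    unfolding det_0_iff_vec_prod_zero[OF A] ex * ** by blast
qed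

lemma solvable_if_det_nonzero:
  fixes a :: "nat \<Rightarrow> nat \<Rightarrow> real"
  assumes "Determinant.det (Matrix.mat n n (\<lambda>(i,j). a i j)) \<noteq> 0"
  shows "\<exists>w. \<forall>i<n. (\<Sum>j<n. a i j * w j) = s i"
proof -
  let ?A = "Matrix.mat n n (\<lambda>(i,j). a i j)"
  have A: "?A \<in> carrier_mat n n" by auto
  from det_non_zero_imp_unit[OF A assms] obtain B where
    B: "B \<in> carrier_mat n n" "?A * B = 1\<^sub>m n"
    by (auto simp: Units_def ring_mat_def)
  let ?s = "Matrix.vec n s"
  let ?w = "B *\<^sub>v ?s"
  have "?A *\<^sub>v ?w = ?s"
    using assoc_mult_mat_vec[OF A B(1), of ?s] B by simp
  then have "vec_index (?A *\<^sub>v ?w) i = s i" if "i < n" for i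
    using that by simp
  then show ?thesis
    using B by (intro exI[of _ "vec_index ?w"]) (auto simp: scalar_prod_def lessThan_atLeast0)
qed

lemma more_vectors_than_coordinates_dependent:
  fixes a :: "nat \<Rightarrow> nat \<Rightarrow> real"
  shows "\<exists>c. (\<exists>i\<le>n. c i \<noteq> 0) \<and> (\<forall>j<n. (\<Sum>i\<le>n. c i * a i j) = 0)"
proof -
  \<comment> \<open>The vectors become columns, and a last row of zeros makes the matrix square and
    singular; a kernel vector holds the coefficients of the relation.\<close>
  let ?b = "\<lambda>i j. if i < n then a j i else 0"
  have *: "(\<Sum>j<Suc n. ?b n j * 1) = (0::real)" by simp
  have "Determinant.det (Matrix.mat (Suc n) (Suc n) (\<lambda>(i,j). ?b i j)) = 0"
  proof (rule ccontr)
    assume "\<not> ?thesis"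
    from solvable_if_det_nonzero[OF this, of "\<lambda>_. 1"] obtain w
      where "\<forall>i<Suc n. (\<Sum>j<Suc n. ?b i j * w j) = 1" by blast
    from this[rule_format, of n] show False by simp
  qed
  then obtain w where w: "\<forall>i<Suc n. (\<Sum>j<Suc n. ?b i j * w j) = 0" "\<not> (\<forall>i<Suc n. w i = 0)"
    using det_nonzero_iff_injective[of "Suc n" ?b] by blast
  show ?thesis
  proof (intro exI[of _ w] conjI allI impI)
    show "\<exists>i\<le>n. w i \<noteq> 0" using w(2) by (auto simp: less_Suc_eq_le)
    fix j assume "j < n"
    then show "(\<Sum>i\<le>n. w i * a i j) = 0"
      using w(1)[rule_format, of j] by (simp add: lessThan_Suc_atMost mult.commute)
  qed
qed

section \<open>Compactness and the optimal design\<close>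

lemma compact_function_box:
  fixes a b :: "'a \<Rightarrow> real"
  shows "compact {p. \<forall>x. a x \<le> p x \<and> p x \<le> b x}"
proof -
  have "{p. \<forall>x. a x \<le> p x \<and> p x \<le> b x} = PiE UNIV (\<lambda>x. {a x..b x})"
    by (auto simp: PiE_def)
  moreover have "compactin (product_topology (\<lambda>_. euclidean) UNIV) (PiE UNIV (\<lambda>x. {a x..b x}))"
    unfolding compactin_PiE by (auto simp: compactin_euclidean_iff)
  ultimately show ?thesis
    by (simp add: euclidean_product_topology compactin_euclidean_iff)
qed

lemma continuous_on_eval: "continuous_on A (\<lambda>p :: 'a \<Rightarrow> real. p x)"
  by (rule continuous_on_subset[OF continuous_on_product_coordinates]) auto


text \<open>At \<open>t = 0\<close> the left-hand side equals 1 and has derivative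
  \<open>g - n\<close>, so it can stay at most 1 only if this derivative is not positive. One
  explicit \<open>t\<close> takes the place of the limit.\<close>

lemma le_of_power_le_one:
  fixes g :: real
  assumes n: "n \<ge> 1" and le: "\<And>t. 0 < t \<Longrightarrow> t < 1 \<Longrightarrow> (1 - t) ^ n * (1 + t / (1 - t) * g) \<le> 1"
  shows "g \<le> n"
proof (rule ccontr)
  assume "\<not> g \<le> n"
  then have g: "g > n" by simp
  define m where "m = real n"
  have m: "m \<ge> 1" "g > m" using n g by (auto simp: m_def)
  \<comment> \<open>After Bernoulli's inequality the gain is \<open>t * (g - m)\<close> and the loss
    at most \<open>t * (m * g * t)\<close>; this \<open>t\<close> makes the loss half of the
    gain.\<close>
  define t where "t = (g - m) / (2 * m * g)"
  have mg: "m * g \<ge> g" "m * g > 0" using m by auto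
  have "g - m < 2 * m * g" using m mg by linarith
  moreover have "0 < 2 * m * g" using mg by linarith
  ultimately have t: "0 < t" "t < 1"
    using m unfolding t_def by (metis diff_gt_0_iff_gt divide_pos_pos, metis divide_less_eq_1_pos)
  have "(1 - t) ^ n * (1 + t / (1 - t) * g) = (1 - t) ^ (n - 1) * (1 + t * (g - 1))"
    using n t by (cases n) (auto simp: field_simps)
  then have "(1 - t) ^ (n - 1) * (1 + t * (g - 1)) \<le> 1"
    using le[OF t] by simp
  moreover have "1 - (m - 1) * t \<le> (1 - t) ^ (n - 1)"
    using Bernoulli_inequality[of "- t" "n - 1"] t n by (simp add: m_def of_nat_diff)
  moreover have "0 \<le> 1 + t * (g - 1)" using t m by simp
  ultimately have "(1 - (m - 1) * t) * (1 + t * (g - 1)) \<le> 1"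
    by (meson mult_right_mono order_trans)
  then have "t * (g - m) \<le> t * ((m - 1) * (g - 1) * t)"
    by (simp add: algebra_simps)
  then have "g - m \<le> (m - 1) * (g - 1) * t"
    using t by simp
  also have "\<dots> \<le> m * g * t"
    using m t by (intro mult_right_mono mult_mono) auto
  also have "\<dots> = (g - m) / 2"
    using m by (simp add: t_def)
  finally show False using m by simp
qed

text \<open>
  Maximality of the determinant of the moment matrix forces the Kiefer--Wolfowitz bound: moving a
  little mass to a point that violates it would increase the determinant.
\<close>

lemma D_optimal_design:
  fixes S :: "(nat \<Rightarrow> real) set"
  assumes n: "n \<ge> 1" and fin: "finite S"
    and spanning: "\<And>w. (\<And>s. s \<in> S \<Longrightarrow> dot n s w = 0) \<Longrightarrow> \<forall>i<n. w i = 0"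
  shows "\<exists>p. (\<forall>s\<in>S. 0 \<le> p s) \<and> sum p S = 1 \<and>
    (\<forall>s\<in>S. \<forall>b. (dot n s b)\<^sup>2 \<le> n * (\<Sum>r\<in>S. p r * (dot n r b)\<^sup>2))"
proof -
  \<comment> \<open>\<open>a p\<close> is the moment matrix of the design \<open>p\<close> and
    \<open>D p\<close> its determinant.\<close>
  define a where "a p i j = (\<Sum>s\<in>S. p s * s i * s j)" for p :: "(nat \<Rightarrow> real) \<Rightarrow> real" and i j
  define D where "D p = Determinant.det (Matrix.mat n n (\<lambda>(i,j). a p i j))" for p
  \<comment> \<open>Weights are functions on all vectors; forcing them to vanish outside
    \<open>S\<close> makes the simplex compact in the product topology.\<close>
  define P where "P = {p :: (nat \<Rightarrow> real) \<Rightarrow> real. \<forall>s. 0 \<le> p s \<and> p s \<le> (if s \<in> S then 1 else 0)}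
    \<inter> {p. sum p S = 1}"
  have form: "(\<Sum>i<n. v i * (\<Sum>j<n. a p i j * w j)) = (\<Sum>s\<in>S. p s * dot n s v * dot n s w)" for p v w
  proof -
    have "(\<Sum>i<n. v i * (\<Sum>j<n. a p i j * w j)) =
        (\<Sum>i<n. \<Sum>j<n. \<Sum>s\<in>S. p s * (s i * v i) * (s j * w j))"
      by (simp add: a_def sum_distrib_left sum_distrib_right mult_ac)
    also have "\<dots> = (\<Sum>s\<in>S. \<Sum>i<n. \<Sum>j<n. p s * (s i * v i) * (s j * w j))"
      by (simp add: sum.swap[of _ S])
    also have "\<dots> = (\<Sum>s\<in>S. p s * dot n s v * dot n s w)"
      by (simp add: dot_def sum_distrib_left sum_distrib_right mult_ac)
    finally show ?thesis .
  qed
  have S: "S \<noteq> {}" using spanning[of "\<lambda>_. 1"] n by auto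
  have "closed {p :: (nat \<Rightarrow> real) \<Rightarrow> real. sum p S = 1}"
    by (intro closed_Collect_eq continuous_intros continuous_on_eval)
  then have comp: "compact P"
    unfolding P_def by (intro compact_Int_closed compact_function_box)
  \<comment> \<open>The uniform design has a nonsingular moment matrix because \<open>S\<close>
    spans, so the maximum below is not zero.\<close>
  define p0 where "p0 = (\<lambda>s. if s \<in> S then 1 / real (card S) else 0)"
  have cS: "card S > 0" using fin S by (simp add: card_gt_0_iff)
  have p0: "p0 \<in> P"
    using fin S cS by (auto simp: P_def p0_def)
  have D0: "D p0 \<noteq> 0"
    unfolding D_def det_nonzero_iff_injective
  proof (intro allI impI)
    fix w i assume w: "\<forall>i<n. (\<Sum>j<n. a p0 i j * w j) = 0" and i: "i < n"
    have "(\<Sum>s\<in>S. p0 s * dot n s w * dot n s w) = 0"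
      unfolding form[symmetric] using w by simp
    then have "\<forall>s\<in>S. p0 s * dot n s w * dot n s w = 0"
      by (subst (asm) sum_nonneg_eq_0_iff[OF fin]) (auto simp: p0_def mult.assoc)
    then have "dot n s w = 0" if "s \<in> S" for s
      using that cS by (auto simp: p0_def)
    then show "w i = 0" using spanning i by blast
  qed
  have "continuous_on P D"
    unfolding D_def a_def
    by (subst det_def'[of _ n]) (auto intro!: continuous_intros continuous_on_eval)
  \<comment> \<open>Maximising the absolute value avoids a discussion of the sign of the
    determinant.\<close>
  then have "continuous_on P (\<lambda>p. \<bar>D p\<bar>)" by (intro continuous_intros)
  from continuous_attains_sup[OF comp _ this] p0 obtain p where
    p: "p \<in> P" and max: "\<And>q. q \<in> P \<Longrightarrow> \<bar>D q\<bar> \<le> \<bar>D p\<bar>" by blast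
  have Dp: "D p \<noteq> 0" using max[OF p0] D0 by auto
  have p': "\<And>s. s \<in> S \<Longrightarrow> 0 \<le> p s" "sum p S = 1" using p by (auto simp: P_def)
  have "(dot n s b)\<^sup>2 \<le> n * (\<Sum>r\<in>S. p r * (dot n r b)\<^sup>2)" if s: "s \<in> S" for s b
  proof -
    from solvable_if_det_nonzero[OF Dp[unfolded D_def], of s] obtain w where
      w: "\<And>i. i < n \<Longrightarrow> (\<Sum>j<n. a p i j * w j) = s i" by blast
    \<comment> \<open>\<open>g\<close> is \<open>s^T A^(-1) s\<close> for the moment matrix
      \<open>A\<close>, the quantity that optimality bounds by \<open>n\<close>.\<close>
    define g where "g = dot n s w"
    have eq: "dot n s v = (\<Sum>r\<in>S. p r * dot n r v * dot n r w)" for v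
      using form[of v p w] w by (simp add: dot_def mult.commute)
    have "(1 - t) ^ n * (1 + t / (1 - t) * g) \<le> 1" if t: "0 < t" "t < 1" for t
    proof -
      \<comment> \<open>The fraction \<open>t\<close> of all mass is moved to \<open>s\<close>; the
        new moment matrix is \<open>1 - t\<close> times a rank-one update of the old one.\<close>
      define q where "q = (\<lambda>x. (1 - t) * p x + (if x = s then t else 0))"
      have q1: "sum q S = 1"
        using fin s p' by (simp add: q_def sum.distrib sum_distrib_left[symmetric])
      have q0: "0 \<le> q x" for x using p t by (auto simp: q_def P_def)
      have "q x \<le> 1" if "x \<in> S" for x
        using member_le_sum[OF that, of q] fin q0 q1 by auto
      moreover have "q x = 0" if "x \<notin> S" for x
      proof -
        have "0 \<le> p x \<and> p x \<le> (if x \<in> S then 1 else 0)" using p unfolding P_def by blast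
        then show ?thesis using that s by (auto simp: q_def)
      qed
      ultimately have "q \<in> P" using q0 q1 by (auto simp: P_def)
      have aq: "a q i j = (1 - t) * (a p i j + t / (1 - t) * s i * s j)" for i j
      proof -
        have "a q i j = (\<Sum>x\<in>S. (1 - t) * (p x * x i * x j) + (if x = s then t * s i * s j else 0))"
          unfolding a_def q_def by (intro sum.cong) (auto simp: algebra_simps)
        also have "\<dots> = (1 - t) * a p i j + t * s i * s j"
          using fin s by (simp add: sum.distrib sum_distrib_left a_def)
        also have "\<dots> = (1 - t) * (a p i j + t / (1 - t) * s i * s j)"
          using t by (simp add: distrib_left)
        finally show ?thesis .
      qed
      have "Matrix.mat n n (\<lambda>(i,j). a q i j) =
          (1 - t) \<cdot>\<^sub>m Matrix.mat n n (\<lambda>(i,j). a p i j + t / (1 - t) * s i * s j)"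
        by (rule eq_matI) (auto simp: aq)
      then have "D q = (1 - t) ^ n * (D p * (1 + t / (1 - t) * g))"
        unfolding D_def g_def using det_rank_one_update[OF w, where t = "t / (1 - t)"] by simp
      then have "\<bar>D q\<bar> = \<bar>D p\<bar> * \<bar>(1 - t) ^ n * (1 + t / (1 - t) * g)\<bar>"
        by (simp add: abs_mult)
      with max[OF \<open>q \<in> P\<close>] Dp have "\<bar>(1 - t) ^ n * (1 + t / (1 - t) * g)\<bar> \<le> 1"
        by simp
      then show ?thesis by simp
    qed
    from le_of_power_le_one[OF n this] have g: "g \<le> n" .
    \<comment> \<open>Cauchy--Schwarz with the weights \<open>p\<close>; the factor belonging to
      \<open>w\<close> equals \<open>g\<close>, which is at most \<open>n\<close>.\<close>
    have "(dot n s b)\<^sup>2 = (\<Sum>r\<in>S. (sqrt (p r) * dot n r b) * (sqrt (p r) * dot n r w))\<^sup>2"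
      unfolding eq[of b] by (intro arg_cong[of _ _ "\<lambda>x. x\<^sup>2"] sum.cong) (auto simp: p' algebra_simps)
    also have "\<dots> \<le> (\<Sum>r\<in>S. (sqrt (p r) * dot n r b)\<^sup>2) * (\<Sum>r\<in>S. (sqrt (p r) * dot n r w)\<^sup>2)"
      by (rule Cauchy_Schwarz_ineq_sum)
    also have "(\<Sum>r\<in>S. (sqrt (p r) * dot n r b)\<^sup>2) = (\<Sum>r\<in>S. p r * (dot n r b)\<^sup>2)"
      by (intro sum.cong) (auto simp: p' power_mult_distrib)
    also have "(\<Sum>r\<in>S. (sqrt (p r) * dot n r w)\<^sup>2) = g"
      unfolding g_def eq by (intro sum.cong) (auto simp: p' power_mult_distrib power2_eq_square)
    also have "(\<Sum>r\<in>S. p r * (dot n r b)\<^sup>2) * g \<le> (\<Sum>r\<in>S. p r * (dot n r b)\<^sup>2) * n"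
      using g p' by (intro mult_left_mono sum_nonneg) auto
    finally show ?thesis by (simp add: mult.commute)
  qed
  then show ?thesis using p' by blast
qed

section \<open>Linear forms in triangular systems\<close>

text \<open>The coordinates are chosen one after another: once the earlier ones are fixed,
  \<open>l c i\<close> runs through an arithmetic progression with step \<open>\<alpha> i\<close>,
  which meets \<open>[0, L i)\<close> at least \<open>M i\<close> times.\<close>

lemma triangular_box_count:
  fixes l r :: "(nat \<Rightarrow> int) \<Rightarrow> nat \<Rightarrow> real" and M :: "nat \<Rightarrow> nat" and \<alpha> L :: "nat \<Rightarrow> real"
  assumes tri: "\<And>c i. i < d \<Longrightarrow> l c i = \<alpha> i * c i + r c i"
    and dep: "\<And>c c' i. i < d \<Longrightarrow> (\<And>j. j < i \<Longrightarrow> c j = c' j) \<Longrightarrow> r c i = r c' i"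
    and pos: "\<And>i. i < d \<Longrightarrow> \<alpha> i > 0"
    and len: "\<And>i. i < d \<Longrightarrow> M i * \<alpha> i \<le> L i"
  shows "\<exists>F. finite F \<and> card F = (\<Prod>i<d. M i) \<and>
    (\<forall>c\<in>F. (\<forall>i\<ge>d. c i = 0) \<and> (\<forall>i<d. 0 \<le> l c i \<and> l c i < L i))"
  using assms
proof (induction d)
  case 0
  show ?case by (intro exI[of _ "{\<lambda>_. 0}"]) auto
next
  case (Suc d)
  have "\<exists>F. finite F \<and> card F = (\<Prod>i<d. M i) \<and>
      (\<forall>c\<in>F. (\<forall>i\<ge>d. c i = 0) \<and> (\<forall>i<d. 0 \<le> l c i \<and> l c i < L i))"
  proof (rule Suc.IH)
    show "r c i = r c' i" if "i < d" "\<And>j. j < i \<Longrightarrow> c j = c' j" for c c' i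
      using that by (intro Suc.prems(2)) auto
  qed (use Suc.prems(1,3,4) less_SucI in blast)+
  then obtain F where F: "finite F" "card F = (\<Prod>i<d. M i)"
    "\<And>c i. c \<in> F \<Longrightarrow> i \<ge> d \<Longrightarrow> c i = 0"
    "\<And>c i. c \<in> F \<Longrightarrow> i < d \<Longrightarrow> 0 \<le> l c i \<and> l c i < L i"
    by blast
  \<comment> \<open>The ceiling is the least value of the coordinate \<open>d\<close> for which the
    form is nonnegative; \<open>M d\<close> consecutive values from there on keep it below
    \<open>L d\<close>.\<close>
  define h where "h = (\<lambda>(c :: nat \<Rightarrow> int, z :: nat). c(d := int z + \<lceil>- r c d / \<alpha> d\<rceil>))"
  have inj: "inj_on h (F \<times> {..<M d})"
  proof (rule inj_onI, clarify)
    fix c z c' z'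
    assume c: "c \<in> F" "c' \<in> F" and eq: "h (c, z) = h (c', z')"
    have "c i = c' i" for i
      using fun_cong[OF eq, of i] F(3)[OF c(1), of i] F(3)[OF c(2), of i]
      by (cases "i = d") (auto simp: h_def)
    then have "c = c'" by blast
    with fun_cong[OF eq, of d] show "c = c' \<and> z = z'" by (auto simp: h_def)
  qed
  show ?case
  proof (intro exI[of _ "h ` (F \<times> {..<M d})"] conjI ballI allI impI)
    show "card (h ` (F \<times> {..<M d})) = (\<Prod>i<Suc d. M i)"
      using F by (simp add: card_image[OF inj] card_cartesian_product)
  next
    fix c' i assume "c' \<in> h ` (F \<times> {..<M d})" "Suc d \<le> i"
    then show "c' i = 0" using F(3) by (auto simp: h_def)
  next
    fix c' i assume "c' \<in> h ` (F \<times> {..<M d})" and i: "i < Suc d"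
    then obtain c z where c: "c \<in> F" "z < M d" and c': "c' = h (c, z)" by auto
    have r: "r c' i = r c i"
      by (rule Suc.prems(2)) (use i in \<open>auto simp: c' h_def\<close>)
    have "0 \<le> l c' i \<and> l c' i < L i"
    proof (cases "i < d")
      case True
      then have "l c' i = l c i"
        using i r by (simp add: Suc.prems(1)) (simp add: c' h_def)
      then show ?thesis using F(4)[OF c(1) True] by simp
    next
      case False
      with i have [simp]: "i = d" by simp
      define k where "k = \<lceil>- r c d / \<alpha> d\<rceil>"
      have \<alpha>: "\<alpha> d > 0" using Suc.prems(3) by simp
      have l: "l c' d = \<alpha> d * (real z + k) + r c d"
        using r by (simp add: Suc.prems(1)) (simp add: c' h_def k_def)
      have "- r c d / \<alpha> d \<le> k" "k < - r c d / \<alpha> d + 1" unfolding k_def by linarith+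
      then have k: "- r c d \<le> \<alpha> d * k" "\<alpha> d * k < - r c d + \<alpha> d"
        using \<alpha> by (auto simp: field_simps)
      have "\<alpha> d * real z \<ge> 0" using \<alpha> by simp
      moreover have "\<alpha> d * (real z + 1) \<le> \<alpha> d * M d"
        using c \<alpha> by (intro mult_left_mono) auto
      ultimately show ?thesis
        using k Suc.prems(4)[of d, unfolded mult.commute[of "real _"], OF lessI] unfolding \<open>i = d\<close> l distrib_left by (intro conjI) linarith+
    qed
    then show "0 \<le> l c' i" "l c' i < L i" by auto
  qed (use F in auto)
qed

text \<open>
  Minkowski's linear form theorem for triangular systems: the solutions with \<open>0 \<le> l c i < N * w i\<close>
  are distributed into \<open>N ^ d\<close> cells, one of which contains many; let \<open>N\<close> tend to infinity.
\<close>

lemma triangular_linear_forms: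
  fixes l r :: "(nat \<Rightarrow> int) \<Rightarrow> nat \<Rightarrow> real" and \<alpha> w :: "nat \<Rightarrow> real"
  assumes tri: "\<And>c i. i < d \<Longrightarrow> l c i = \<alpha> i * c i + r c i"
    and dep: "\<And>c c' i. i < d \<Longrightarrow> (\<And>j. j < i \<Longrightarrow> c j = c' j) \<Longrightarrow> r c i = r c' i"
    and diff: "\<And>c c' i. i < d \<Longrightarrow> l (\<lambda>j. c j - c' j) i = l c i - l c' i"
    and pos: "\<And>i. i < d \<Longrightarrow> \<alpha> i > 0" and w: "\<And>i. i < d \<Longrightarrow> w i > 0"
    and C: "C = {c. (\<forall>i\<ge>d. c i = 0) \<and> (\<forall>i<d. \<bar>l c i\<bar> < w i)}" "finite C"
  shows "(\<Prod>i<d. w i / \<alpha> i) \<le> card C"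
proof -
  have *: "(\<Prod>i<d. real (nat \<lfloor>N * w i / \<alpha> i\<rfloor>) / N) \<le> card C" if N: "N > 0" for N :: nat
  proof -
    have "\<exists>F. finite F \<and> card F = (\<Prod>i<d. nat \<lfloor>N * w i / \<alpha> i\<rfloor>) \<and>
      (\<forall>c\<in>F. (\<forall>i\<ge>d. c i = 0) \<and> (\<forall>i<d. 0 \<le> l c i \<and> l c i < N * w i))"
    proof (rule triangular_box_count[where l = l and r = r and \<alpha> = \<alpha>, OF tri dep pos])
      fix i assume "i < d"
      then have a: "\<alpha> i > 0" "w i > 0" using pos w by auto
      then have "0 \<le> N * w i / \<alpha> i" by simp
      then have "real (nat \<lfloor>N * w i / \<alpha> i\<rfloor>) \<le> N * w i / \<alpha> i" by linarith
      then show "real (nat \<lfloor>N * w i / \<alpha> i\<rfloor>) * \<alpha> i \<le> N * w i"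
        using a(1) by (simp only: pos_le_divide_eq)
    qed
    then obtain F where F: "finite F" "card F = (\<Prod>i<d. nat \<lfloor>N * w i / \<alpha> i\<rfloor>)"
      "\<And>c i. c \<in> F \<Longrightarrow> i \<ge> d \<Longrightarrow> c i = 0"
      "\<And>c i. c \<in> F \<Longrightarrow> i < d \<Longrightarrow> 0 \<le> l c i \<and> l c i < N * w i" by metis
    \<comment> \<open>Cells are boxes with side lengths \<open>w i\<close>, so two solutions in one
      cell differ by less than \<open>w i\<close> in every form.\<close>
    define cell where "cell c = (\<lambda>i\<in>{..<d}. nat \<lfloor>l c i / w i\<rfloor>)" for c
    have "cell \<in> F \<rightarrow> (PiE {..<d} (\<lambda>_. {..<N}))"
    proof (intro funcsetI PiE_I)
      fix c i assume c: "c \<in> F" and "i \<in> {..<d}"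
      then have "0 \<le> l c i / w i" "l c i / w i < N"
        using F(4)[OF c, of i] w[of i] by (auto simp: field_simps)
      then have "nat \<lfloor>l c i / w i\<rfloor> < N" by linarith
      then show "cell c i \<in> {..<N}" using \<open>i \<in> _\<close> by (simp add: cell_def)
    qed (auto simp: cell_def)
    then have "\<exists>y\<in>PiE {..<d} (\<lambda>_. {..<N}). card (cell -` {y} \<inter> F) * card (PiE {..<d} (\<lambda>_. {..<N})) \<ge> card F"
      using F(1) N by (intro pigeonhole_card) (auto simp: PiE_eq_empty_iff intro!: finite_PiE)
    then obtain y where y: "card (cell -` {y} \<inter> F) * N ^ d \<ge> card F"
      by (auto simp: card_PiE)
    define G where "G = cell -` {y} \<inter> F"
    have "card G \<le> card C"
    proof (cases "G = {}")
      case False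
      then obtain c0 where c0: "c0 \<in> G" by blast
      \<comment> \<open>Translating the crowded cell by one of its own points sends it injectively
        into \<open>C\<close>.\<close>
      show ?thesis
      proof (rule card_inj_on_le[of "\<lambda>c j. c j - c0 j"])
        show "inj_on (\<lambda>c j. c j - c0 j) G"
          by (rule inj_onI) (metis (no_types, lifting) diff_add_cancel ext)
        show "(\<lambda>c j. c j - c0 j) ` G \<subseteq> C"
        proof (rule image_subsetI)
          fix c assume c: "c \<in> G"
          have "\<bar>l c i - l c0 i\<bar> < w i" if i: "i < d" for i
          proof -
            have "cell c i = cell c0 i" using c c0 by (auto simp: G_def)
            moreover have "0 \<le> l c i / w i" "0 \<le> l c0 i / w i"
              using F(4)[of c i] F(4)[of c0 i] c c0 w[OF i] i by (auto simp: G_def)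
            ultimately have "\<bar>l c i / w i - l c0 i / w i\<bar> < 1"
              using i unfolding cell_def by simp linarith
            then show ?thesis
              using w[OF i] by (simp add: diff_divide_distrib[symmetric] abs_divide)
          qed
          moreover have "c i = 0" "c0 i = 0" if "i \<ge> d" for i
            using F(3)[OF _ that] c c0 by (auto simp: G_def)
          ultimately show "(\<lambda>j. c j - c0 j) \<in> C" by (auto simp: C diff)
        qed
      qed (rule C)
    qed simp
    then have "card F \<le> card C * N ^ d"
      using y unfolding G_def[symmetric] by (meson mult_le_mono1 order_trans)
    then have "real (card F) \<le> card C * real N ^ d"
      by (metis of_nat_le_iff of_nat_mult of_nat_power)
    then show ?thesis
      using N by (simp add: F(2) prod_dividef field_simps)
  qed
  \<comment> \<open>Rounding down costs at most \<open>1 / N\<close> in each factor, which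
    disappears in the limit.\<close>
  have "(\<lambda>N. \<Prod>i<d. real (nat \<lfloor>real N * w i / \<alpha> i\<rfloor>) / real N) \<longlonglongrightarrow> (\<Prod>i<d. w i / \<alpha> i)"
  proof (intro tendsto_prod)
    fix i assume "i \<in> {..<d}"
    then have x: "w i / \<alpha> i > 0" using pos w by simp
    define x where "x = w i / \<alpha> i"
    have "(\<lambda>N. real (nat \<lfloor>real N * x\<rfloor>) / real N) \<longlonglongrightarrow> x"
    proof (rule tendsto_sandwich)
      show "\<forall>\<^sub>F N in sequentially. x - 1 / real N \<le> real (nat \<lfloor>real N * x\<rfloor>) / real N"
        using eventually_gt_at_top[of 0]
      proof eventually_elim
        case (elim N)
        have "(real N * x - 1) / real N \<le> real (nat \<lfloor>real N * x\<rfloor>) / real N"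
          by (intro divide_right_mono) linarith+
        then show ?case using elim by (simp add: diff_divide_distrib)
      qed
      show "\<forall>\<^sub>F N in sequentially. real (nat \<lfloor>real N * x\<rfloor>) / real N \<le> x"
        using eventually_gt_at_top[of 0]
      proof eventually_elim
        case (elim N)
        have "0 \<le> real N * x" using x unfolding x_def[symmetric] by simp
        then have "real (nat \<lfloor>real N * x\<rfloor>) / real N \<le> real N * x / real N"
          by (intro divide_right_mono) linarith+
        then show ?case using elim by simp
      qed
      show "(\<lambda>N. x - 1 / real N) \<longlonglongrightarrow> x"
        using tendsto_diff[OF tendsto_const lim_inverse_n'] by simp
    qed simp
    then show "(\<lambda>N. real (nat \<lfloor>real N * w i / \<alpha> i\<rfloor>) / real N) \<longlonglongrightarrow> w i / \<alpha> i"
      by (simp add: x_def)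
  qed
  then show ?thesis
    by (rule LIMSEQ_le_const2) (use * in \<open>auto intro!: exI[of _ 1]\<close>)
qed

section \<open>Reduced bases\<close>

lemma Rn_iff: "x \<in> Rn n \<longleftrightarrow> (\<forall>i\<ge>n. x i = 0)"
  by (simp add: topspace_Euclidean_space)

lemma Zn_iff: "x \<in> Zn n \<longleftrightarrow> (\<forall>i\<ge>n. x i = 0) \<and> (\<forall>i. x i \<in> \<int>)"
  by (simp add: Zn_def Rn_iff)

definition coord_vec :: "nat \<Rightarrow> nat \<Rightarrow> real" where
  "coord_vec i = (\<lambda>j. if j = i then 1 else 0)"

definition lincomb :: "nat \<Rightarrow> (nat \<Rightarrow> real) \<Rightarrow> (nat \<Rightarrow> nat \<Rightarrow> real) \<Rightarrow> nat \<Rightarrow> real" where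
  "lincomb k c f = (\<lambda>t. \<Sum>i<k. c i * f i t)"

definition intspan :: "nat \<Rightarrow> (nat \<Rightarrow> nat \<Rightarrow> real) \<Rightarrow> (nat \<Rightarrow> real) set" where
  "intspan k b = range (\<lambda>c :: nat \<Rightarrow> int. lincomb k (\<lambda>i. of_int (c i)) b)"

lemma lincomb_Suc: "lincomb (Suc k) c f = (\<lambda>t. lincomb k c f t + c k * f k t)"
  by (simp add: lincomb_def)

lemma lincomb_in_Rn: "(\<And>i. i < k \<Longrightarrow> f i \<in> Rn n) \<Longrightarrow> lincomb k c f \<in> Rn n"
  by (auto simp: lincomb_def Rn_iff)

lemma lincomb_in_Zn:
  "(\<And>i. i < k \<Longrightarrow> f i \<in> Zn n) \<Longrightarrow> (\<And>i. i < k \<Longrightarrow> c i \<in> \<int>) \<Longrightarrow> lincomb k c f \<in> Zn n"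
  by (auto simp: lincomb_def Zn_iff intro!: Ints_sum Ints_mult)

lemma intspan_subset_Zn: "(\<And>i. i < k \<Longrightarrow> b i \<in> Zn n) \<Longrightarrow> intspan k b \<subseteq> Zn n"
  by (auto simp: intspan_def intro!: lincomb_in_Zn)

lemma intspan_Suc_iff:
  "v \<in> intspan (Suc k) b \<longleftrightarrow> (\<exists>c :: int. (\<lambda>t. v t - c * b k t) \<in> intspan k b)"
proof
  assume "v \<in> intspan (Suc k) b"
  then obtain c :: "nat \<Rightarrow> int" where "v = lincomb (Suc k) (\<lambda>i. of_int (c i)) b"
    by (auto simp: intspan_def)
  then have "(\<lambda>t. v t - c k * b k t) = lincomb k (\<lambda>i. of_int (c i)) b"
    by (simp add: lincomb_Suc)
  then show "\<exists>c :: int. (\<lambda>t. v t - c * b k t) \<in> intspan k b"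
    by (auto simp: intspan_def)
next
  assume "\<exists>c :: int. (\<lambda>t. v t - c * b k t) \<in> intspan k b"
  then obtain z :: int and c :: "nat \<Rightarrow> int" where
    zc: "(\<lambda>t. v t - z * b k t) = lincomb k (\<lambda>i. of_int (c i)) b"
    by (auto simp: intspan_def)
  have "v = lincomb (Suc k) (\<lambda>i. of_int ((c(k := z)) i)) b"
  proof
    fix t
    show "v t = lincomb (Suc k) (\<lambda>i. of_int ((c(k := z)) i)) b t"
      using fun_cong[OF zc, of t] by (simp add: lincomb_def)
  qed
  then show "v \<in> intspan (Suc k) b"
    unfolding intspan_def by blast
qed

lemma intspan_cong: "(\<And>i. i < k \<Longrightarrow> b i = b' i) \<Longrightarrow> intspan k b = intspan k b'"
  by (simp add: intspan_def lincomb_def)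

lemma intspan_diff_iff:
  assumes "j < k"
  shows "(\<lambda>t. v t - of_int z * b j t) \<in> intspan k b \<longleftrightarrow> v \<in> intspan k b"
proof -
  have *: "(\<lambda>t. v t + of_int z * b j t) \<in> intspan k b" if "v \<in> intspan k b" for v and z :: int
  proof -
    from that obtain c :: "nat \<Rightarrow> int" where v: "v = lincomb k (\<lambda>i. of_int (c i)) b"
      by (auto simp: intspan_def)
    have "(\<lambda>t. v t + of_int z * b j t) = lincomb k (\<lambda>i. of_int ((c(j := c j + z)) i)) b"
    proof
      fix t
      have "lincomb k (\<lambda>i. of_int ((c(j := c j + z)) i)) b t =
        (\<Sum>i<k. of_int (c i) * b i t + (if i = j then of_int z * b j t else 0))"
        unfolding lincomb_def by (intro sum.cong) (auto simp: algebra_simps)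
      then show "v t + of_int z * b j t = lincomb k (\<lambda>i. of_int ((c(j := c j + z)) i)) b t"
        using assms by (simp add: v lincomb_def sum.distrib)
    qed
    then show ?thesis unfolding intspan_def by blast
  qed
  show ?thesis
    using *[of v "- z"] *[of "\<lambda>t. v t - of_int z * b j t" z] by auto
qed

lemma finite_Zn_box: "finite {x \<in> Zn n. \<forall>i<n. \<bar>x i\<bar> \<le> R}"
proof (rule finite_subset)
  let ?F = "PiE {..<n} (\<lambda>_. {- \<lceil>R\<rceil>..\<lceil>R\<rceil>})"
  show "finite ((\<lambda>f i. if i < n then real_of_int (f i) else 0) ` ?F)"
    by (intro finite_imageI finite_PiE) auto
  show "{x \<in> Zn n. \<forall>i<n. \<bar>x i\<bar> \<le> R} \<subseteq> (\<lambda>f i. if i < n then real_of_int (f i) else 0) ` ?F"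
  proof
    fix x assume x: "x \<in> {x \<in> Zn n. \<forall>i<n. \<bar>x i\<bar> \<le> R}"
    let ?f = "\<lambda>i\<in>{..<n}. \<lfloor>x i\<rfloor>"
    have "x = (\<lambda>i. if i < n then real_of_int (?f i) else 0)"
      using x by (auto simp: Zn_iff fun_eq_iff)
    moreover have "?f \<in> ?F"
    proof (rule PiE_I)
      fix i assume "i \<in> {..<n}"
      then have "\<bar>x i\<bar> \<le> R" using x by auto
      then show "?f i \<in> {- \<lceil>R\<rceil>..\<lceil>R\<rceil>}" using \<open>i \<in> _\<close> by simp linarith
    qed auto
    ultimately show "x \<in> (\<lambda>f i. if i < n then real_of_int (f i) else 0) ` ?F" by blast
  qed
qed

text \<open>The rounding step of size reduction: \<open>x\<close> will be a Gram--Schmidt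
  coefficient and \<open>a\<close> the Gram--Schmidt length at the same index.\<close>

lemma abs_minus_round_multiple_le:
  fixes x a :: real
  assumes "a > 0"
  shows "\<bar>x - of_int (round (x / a)) * a\<bar> \<le> a / 2"
proof -
  have "\<bar>x / a - of_int (round (x / a))\<bar> * a \<le> 1 / 2 * a"
    using assms of_int_round_abs_le[of "x / a"] by (intro mult_right_mono) (auto simp: abs_minus_commute)
  also have "\<bar>x / a - of_int (round (x / a))\<bar> * a = \<bar>(x / a - of_int (round (x / a))) * a\<bar>"
    using assms by (simp add: abs_mult)
  also have "(x / a - of_int (round (x / a))) * a = x - of_int (round (x / a)) * a"
    using assms by (simp add: left_diff_distrib)
  finally show ?thesis by simp
qed

text \<open>The form lives on all functions but is compared with the coordinates only on
  \<open>Rn n\<close>. The constant \<open>\<kappa>\<close> makes it definite there and leaves only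
  finitely many integer points in each ball of the form.\<close>

locale positive_form =
  fixes n :: nat and B :: "(nat \<Rightarrow> real) \<Rightarrow> (nat \<Rightarrow> real) \<Rightarrow> real" and \<kappa> :: real
  assumes sym: "B x y = B y x"
    and add_left: "B (\<lambda>t. x t + y t) z = B x z + B y z"
    and scale_left: "B (\<lambda>t. c * x t) z = c * B x z"
    and nonneg: "B x x \<ge> 0"
    and \<kappa>_nonneg: "\<kappa> \<ge> 0"
    and coordinate_le: "x \<in> Rn n \<Longrightarrow> i < n \<Longrightarrow> (x i)\<^sup>2 \<le> \<kappa> * B x x"
begin

section \<open>Orthonormal systems and projections for the form\<close>

lemma zero_left: "B (\<lambda>_. 0) z = 0"
  using scale_left[of 0 "\<lambda>_. 0" z] by simp

lemma diff_left: "B (\<lambda>t. x t - c * y t) z = B x z - c * B y z"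
  using add_left[of x "\<lambda>t. - c * y t" z] scale_left[of "- c" y z] by simp

lemma diff_right: "B z (\<lambda>t. x t - c * y t) = B z x - c * B z y"
  by (metis diff_left sym)

lemma lincomb_left: "B (lincomb k c f) z = (\<Sum>i<k. c i * B (f i) z)"
proof (induction k)
  case 0
  then show ?case using zero_left by (simp add: lincomb_def)
next
  case (Suc k)
  then show ?case
    using add_left[of "lincomb k c f" "\<lambda>t. c k * f k t" z] scale_left[of "c k" "f k" z]
    by (simp add: lincomb_Suc)
qed

lemma zero_if_form_zero:
  assumes "x \<in> Rn n" "B x x = 0"
  shows "x = (\<lambda>_. 0)"
proof
  fix i show "x i = 0"
    using coordinate_le[of x i] assms by (cases "i < n") (auto simp: Rn_iff)
qed

definition orthonormal :: "nat \<Rightarrow> (nat \<Rightarrow> nat \<Rightarrow> real) \<Rightarrow> bool" where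
  "orthonormal k u \<longleftrightarrow> (\<forall>i<k. u i \<in> Rn n) \<and> (\<forall>i<k. \<forall>j<k. B (u i) (u j) = (if i = j then 1 else 0))"

definition proj :: "nat \<Rightarrow> (nat \<Rightarrow> nat \<Rightarrow> real) \<Rightarrow> (nat \<Rightarrow> real) \<Rightarrow> nat \<Rightarrow> real" where
  "proj k u v = lincomb k (\<lambda>j. B v (u j)) u"

definition rej :: "nat \<Rightarrow> (nat \<Rightarrow> nat \<Rightarrow> real) \<Rightarrow> (nat \<Rightarrow> real) \<Rightarrow> nat \<Rightarrow> real" where
  "rej k u v = (\<lambda>t. v t - proj k u v t)"

text \<open>For orthonormal \<open>u\<close> this is the squared distance from \<open>v\<close> to
  the span of \<open>u 0, ..., u (k - 1)\<close>, by \<open>rej_rej\<close>.\<close>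

definition dist2 :: "nat \<Rightarrow> (nat \<Rightarrow> nat \<Rightarrow> real) \<Rightarrow> (nat \<Rightarrow> real) \<Rightarrow> real" where
  "dist2 k u v = B v v - (\<Sum>j<k. (B v (u j))\<^sup>2)"

lemma orthonormal_lincomb:
  assumes "orthonormal k u" "j < k" "m \<le> k"
  shows "B (lincomb m c u) (u j) = (if j < m then c j else 0)"
proof -
  have "B (lincomb m c u) (u j) = (\<Sum>i<m. if i = j then c j else 0)"
    unfolding lincomb_left using assms by (intro sum.cong) (auto simp: orthonormal_def)
  then show ?thesis by simp
qed

lemma orthonormal_mono: "orthonormal k u \<Longrightarrow> m \<le> k \<Longrightarrow> orthonormal m u"
  by (auto simp: orthonormal_def)

lemma proj_in_Rn: "orthonormal k u \<Longrightarrow> proj k u v \<in> Rn n"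
  unfolding proj_def by (rule lincomb_in_Rn) (auto simp: orthonormal_def)

lemma rej_in_Rn: "orthonormal k u \<Longrightarrow> v \<in> Rn n \<Longrightarrow> rej k u v \<in> Rn n"
  using proj_in_Rn[of k u v] by (auto simp: rej_def Rn_iff)

lemma rej_left: "B (rej k u v) z = B v z - B (proj k u v) z"
  using diff_left[of v 1 "proj k u v" z] by (simp add: rej_def)

lemma rej_orthogonal: "orthonormal k u \<Longrightarrow> j < k \<Longrightarrow> B (rej k u v) (u j) = 0"
  by (simp add: rej_left proj_def orthonormal_lincomb)

lemma rej_rej:
  assumes "orthonormal k u"
  shows "B (rej k u v) (rej k u v) = dist2 k u v"
proof -
  have "B (rej k u v) (rej k u v) = B (rej k u v) v - B (proj k u v) (rej k u v)"
    using diff_right[of "rej k u v" v 1 "proj k u v"] sym[of "rej k u v" "proj k u v"]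
    by (simp add: rej_def)
  also have "B (proj k u v) (rej k u v) = (\<Sum>j<k. B v (u j) * B (rej k u v) (u j))"
    unfolding proj_def lincomb_left by (simp only: sym[of "u _" "rej k u v"])
  also have "\<dots> = 0"
    using rej_orthogonal[OF assms] by simp
  also have "B (rej k u v) v = dist2 k u v"
    by (simp add: rej_left proj_def lincomb_left dist2_def power2_eq_square sym[of "u _" v])
  finally show ?thesis by simp
qed

lemma dist2_nonneg: "orthonormal k u \<Longrightarrow> dist2 k u v \<ge> 0"
  using rej_rej nonneg by metis

lemma dist2_Suc: "dist2 k u v = dist2 (Suc k) u v + (B v (u k))\<^sup>2"
  by (simp add: dist2_def)

text \<open>The \<open>u j\<close> and the rejection of \<open>v\<close> are \<open>n + 1\<close>
  vectors with \<open>n\<close> coordinates, hence dependent. Pairing the relation with each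
  \<open>u j\<close> kills its coefficient, so only the rejection remains and must vanish.\<close>

lemma orthonormal_complete:
  assumes u: "orthonormal n u" and v: "v \<in> Rn n"
  shows "v = proj n u v"
proof -
  define f where "f = (\<lambda>i. if i < n then u i else rej n u v)"
  obtain c where c: "\<exists>i\<le>n. c i \<noteq> 0" "\<And>j. j < n \<Longrightarrow> (\<Sum>i\<le>n. c i * f i j) = 0"
    using more_vectors_than_coordinates_dependent[of n f] by blast
  have fR: "f i \<in> Rn n" for i
    using u v rej_in_Rn by (auto simp: f_def orthonormal_def)
  have zero: "lincomb (Suc n) c f = (\<lambda>_. 0)"
  proof
    fix t show "lincomb (Suc n) c f t = 0"
      using c(2)[of t] fR by (cases "t < n") (auto simp: lincomb_def lessThan_Suc_atMost Rn_iff)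
  qed
  have cj: "c j = 0" if j: "j < n" for j
  proof -
    have "0 = (\<Sum>i<Suc n. c i * B (f i) (u j))"
      using lincomb_left[of "Suc n" c f "u j"] by (simp only: zero zero_left)
    also have "\<dots> = (\<Sum>i<n. c i * B (u i) (u j)) + c n * B (rej n u v) (u j)"
      by (simp add: f_def)
    also have "\<dots> = B (lincomb n c u) (u j)"
      using rej_orthogonal[OF u j] by (simp add: lincomb_left)
    also have "\<dots> = c j" using orthonormal_lincomb[OF u j] j by simp
    finally show ?thesis by simp
  qed
  then have cn: "c n \<noteq> 0" using c(1) by (metis le_neq_implies_less)
  have "rej n u v t = 0" for t
    using fun_cong[OF zero, of t] cj cn by (simp add: lincomb_def f_def)
  then show ?thesis by (auto simp: rej_def fun_eq_iff)
qed

lemma parseval: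
  assumes u: "orthonormal n u" and v: "v \<in> Rn n"
  shows "B v v = (\<Sum>j<n. (B v (u j))\<^sup>2)"
  using rej_rej[OF u, of v] orthonormal_complete[OF u v, symmetric] zero_left
  by (simp add: rej_def dist2_def)

text \<open>
  A Hermite--Korkine--Zolotarev reduced system, with the Gram--Schmidt vectors normalised to \<open>u i\<close>
  and their lengths recorded as \<open>\<alpha> i\<close>.
\<close>

definition hkz :: "nat \<Rightarrow> (nat \<Rightarrow> nat \<Rightarrow> real) \<Rightarrow> (nat \<Rightarrow> nat \<Rightarrow> real) \<Rightarrow> (nat \<Rightarrow> real) \<Rightarrow> bool" where
  "hkz k b u \<alpha> \<longleftrightarrow> orthonormal k u \<and>
    (\<forall>i<k. b i \<in> Zn n \<and> \<alpha> i > 0 \<and> b i = proj (Suc i) u (b i) \<and> B (b i) (u i) = \<alpha> i \<and>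
      (\<forall>j<i. \<bar>B (b i) (u j)\<bar> \<le> \<alpha> j / 2) \<and>
      (\<forall>v\<in>Zn n. v \<notin> intspan i b \<longrightarrow> (\<alpha> i)\<^sup>2 \<le> dist2 i u v))"

section \<open>Construction of the reduced basis\<close>

lemma hkz_mono: "hkz k b u \<alpha> \<Longrightarrow> m \<le> k \<Longrightarrow> hkz m b u \<alpha>"
  by (auto simp: hkz_def intro: orthonormal_mono)

lemma hkz_triangular:
  assumes "hkz k b u \<alpha>" "i < j" "j < k"
  shows "B (b i) (u j) = 0"
proof -
  have "b i = proj (Suc i) u (b i)" and u: "orthonormal k u" using assms by (auto simp: hkz_def)
  then have "B (b i) (u j) = B (proj (Suc i) u (b i)) (u j)" by simp
  then show ?thesis
    unfolding proj_def using assms u by (simp add: orthonormal_lincomb)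
qed

lemma hkz_intspan_orthogonal:
  assumes "hkz k b u \<alpha>" "v \<in> intspan m b" "m \<le> j" "j < k"
  shows "B v (u j) = 0"
proof -
  obtain c :: "nat \<Rightarrow> int" where "v = lincomb m (\<lambda>i. of_int (c i)) b"
    using assms(2) by (auto simp: intspan_def)
  then show ?thesis
    using assms by (auto simp: lincomb_left intro!: sum.neutral hkz_triangular)
qed

lemma hkz_intspan_proj:
  assumes "hkz k b u \<alpha>" "v \<in> intspan k b"
  shows "v = proj k u v"
proof -
  have u: "orthonormal k u" using assms by (simp add: hkz_def)
  have "lincomb k c b = proj k u (lincomb k c b)" for c
  proof
    fix t
    have "b i t = (\<Sum>j<k. B (b i) (u j) * u j t)" if i: "i < k" for i
    proof -
      have "b i t = proj (Suc i) u (b i) t"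
        using assms i by (metis hkz_def)
      also have "\<dots> = (\<Sum>j<k. B (b i) (u j) * u j t)"
        unfolding proj_def lincomb_def
        using i hkz_triangular[OF assms(1), of i] by (intro sum.mono_neutral_left) auto
      finally show ?thesis .
    qed
    then have "lincomb k c b t = (\<Sum>i<k. \<Sum>j<k. c i * B (b i) (u j) * u j t)"
      by (simp add: lincomb_def sum_distrib_left mult.assoc)
    also have "\<dots> = (\<Sum>j<k. \<Sum>i<k. c i * B (b i) (u j) * u j t)"
      by (rule sum.swap)
    also have "\<dots> = proj k u (lincomb k c b) t"
      unfolding proj_def lincomb_left by (simp add: lincomb_def sum_distrib_right)
    finally show "lincomb k c b t = proj k u (lincomb k c b) t" .
  qed
  then show ?thesis using assms(2) by (auto simp: intspan_def)
qed

lemma dist2_diff_intspan: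
  assumes "hkz k b u \<alpha>" "j < k"
  shows "dist2 k u (\<lambda>t. v t - c * b j t) = dist2 k u v"
proof -
  have u: "orthonormal k u" using assms by (simp add: hkz_def)
  have "b j = proj k u (b j)"
  proof -
    have "b j \<in> intspan k b"
      using intspan_diff_iff[OF assms(2), of "\<lambda>_. 0" "- 1" b]
      by (auto simp: intspan_def lincomb_def intro!: image_eqI[of _ _ "\<lambda>_. 0"])
    then show ?thesis using hkz_intspan_proj assms by blast
  qed
  moreover have "proj k u (\<lambda>t. v t - c * b j t) t = proj k u v t - c * proj k u (b j) t" for t
    by (simp add: proj_def lincomb_def diff_left left_diff_distrib sum_subtractf sum_distrib_left mult.assoc)
  ultimately have "rej k u (\<lambda>t. v t - c * b j t) = rej k u v"
    by (auto simp: rej_def fun_eq_iff)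
  then show ?thesis using rej_rej[OF u] by metis
qed

lemma proj_cong: "(\<And>i. i < k \<Longrightarrow> u i = u' i) \<Longrightarrow> proj k u v = proj k u' v"
  by (simp add: proj_def lincomb_def)

lemma dist2_cong: "(\<And>i. i < k \<Longrightarrow> u i = u' i) \<Longrightarrow> dist2 k u v = dist2 k u' v"
  by (simp add: dist2_def)

text \<open>Rounding away the last coefficient leaves a vector at distance at most
  \<open>\<alpha> m / 2\<close> from the span of the earlier vectors, which the minimality of
  \<open>\<alpha> m\<close> permits only inside their integer span. This is the primitivity of the
  system.\<close>

lemma hkz_intspan_if_dist2_zero:
  assumes hkz: "hkz k b u \<alpha>" and v: "v \<in> Zn n" and dist: "dist2 k u v = 0"
  shows "v \<in> intspan k b"
proof (cases k)
  case 0
  then have "v = (\<lambda>_. 0)"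
    using v dist by (intro zero_if_form_zero) (auto simp: Zn_def dist2_def)
  then show ?thesis by (auto simp: 0 intspan_def lincomb_def)
next
  case (Suc m)
  define z where "z = round (B v (u m) / \<alpha> m)"
  define v' where "v' = (\<lambda>t. v t - of_int z * b m t)"
  have \<alpha>: "\<alpha> m > 0" "B (b m) (u m) = \<alpha> m" "b m \<in> Zn n"
    and min: "\<And>v. v \<in> Zn n \<Longrightarrow> v \<notin> intspan m b \<Longrightarrow> (\<alpha> m)\<^sup>2 \<le> dist2 m u v"
    using hkz by (auto simp: hkz_def Suc)
  have "dist2 (Suc m) u v' = 0"
    using dist2_diff_intspan[OF hkz, of m v "of_int z"] dist by (simp add: v'_def Suc)
  moreover have "\<bar>B v' (u m)\<bar> \<le> \<alpha> m / 2"
    using abs_minus_round_multiple_le[OF \<alpha>(1), of "B v (u m)"] \<alpha>(2) by (simp add: v'_def z_def diff_left)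
  then have "(B v' (u m))\<^sup>2 \<le> (\<alpha> m / 2)\<^sup>2"
    using \<alpha>(1) by (simp add: abs_le_square_iff[symmetric])
  moreover have "(\<alpha> m / 2)\<^sup>2 < (\<alpha> m)\<^sup>2"
    using \<alpha>(1) by (intro power_strict_mono) auto
  ultimately have "dist2 m u v' < (\<alpha> m)\<^sup>2"
    using dist2_Suc[of m u v'] by simp
  moreover have "v' \<in> Zn n"
    using v \<alpha>(3) by (auto simp: v'_def Zn_iff)
  ultimately have "v' \<in> intspan m b" using min[of v'] by fastforce
  then show ?thesis unfolding Suc intspan_Suc_iff v'_def by blast
qed

text \<open>Subtracting a multiple of \<open>b i\<close> changes only the coefficients at indices up
  to \<open>i\<close>, so rounding from index \<open>k - 1\<close> downwards never spoils what has
  been achieved.\<close>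

lemma hkz_size_reduce:
  assumes hkz: "hkz k b u \<alpha>" and v: "v \<in> Zn n" "v \<notin> intspan k b"
  shows "\<exists>v'\<in>Zn n. v' \<notin> intspan k b \<and> dist2 k u v' = dist2 k u v \<and> (\<forall>j<k. \<bar>B v' (u j)\<bar> \<le> \<alpha> j / 2)"
proof -
  have "\<exists>v'\<in>Zn n. v' \<notin> intspan k b \<and> dist2 k u v' = dist2 k u v \<and>
      (\<forall>j<k. k - m \<le> j \<longrightarrow> \<bar>B v' (u j)\<bar> \<le> \<alpha> j / 2)" if "m \<le> k" for m
    using that
  proof (induction m)
    case 0
    then show ?case using v by auto
  next
    case (Suc m)
    then obtain w where w: "w \<in> Zn n" "w \<notin> intspan k b" "dist2 k u w = dist2 k u v"
      "\<And>j. j < k \<Longrightarrow> k - m \<le> j \<Longrightarrow> \<bar>B w (u j)\<bar> \<le> \<alpha> j / 2" by auto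
    define i where "i = k - Suc m"
    have i: "i < k" using Suc.prems by (simp add: i_def)
    define z where "z = round (B w (u i) / \<alpha> i)"
    define w' where "w' = (\<lambda>t. w t - of_int z * b i t)"
    have \<alpha>: "\<alpha> i > 0" "B (b i) (u i) = \<alpha> i" "b i \<in> Zn n"
      using hkz i by (auto simp: hkz_def)
    have "\<bar>B w' (u i)\<bar> \<le> \<alpha> i / 2"
      using abs_minus_round_multiple_le[OF \<alpha>(1), of "B w (u i)"] \<alpha>(2) by (simp add: w'_def z_def diff_left)
    moreover have "B w' (u j) = B w (u j)" if "i < j" "j < k" for j
      using hkz_triangular[OF hkz that] by (simp add: w'_def diff_left)
    moreover have "j = i \<or> (i < j \<and> k - m \<le> j)" if "k - Suc m \<le> j" "j < k" for j
      using that by (auto simp: i_def)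
    ultimately have "\<forall>j<k. k - Suc m \<le> j \<longrightarrow> \<bar>B w' (u j)\<bar> \<le> \<alpha> j / 2"
      using w(4) by metis
    moreover have "w' \<in> Zn n" using w(1) \<alpha>(3) by (auto simp: w'_def Zn_iff)
    moreover have "w' \<notin> intspan k b"
      using w(2) intspan_diff_iff[OF i] by (simp add: w'_def)
    moreover have "dist2 k u w' = dist2 k u v"
      using w(3) dist2_diff_intspan[OF hkz i] by (simp add: w'_def)
    ultimately show ?case by blast
  qed
  from this[of k] show ?thesis by auto
qed

text \<open>The new vector is an integer vector outside the integer span that is closest to the real
  span. Size reduction keeps the distance, so the minimum can be sought among finitely many
  candidates.\<close>

lemma hkz_extend:
  assumes hkz: "hkz k b u \<alpha>" and v: "v \<in> Zn n" "v \<notin> intspan k b"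
  shows "\<exists>b' u' \<alpha>'. hkz (Suc k) b' u' \<alpha>'"
proof -
  have u: "orthonormal k u" using hkz by (simp add: hkz_def)
  obtain v0 where v0: "v0 \<in> Zn n" "v0 \<notin> intspan k b" "\<And>j. j < k \<Longrightarrow> \<bar>B v0 (u j)\<bar> \<le> \<alpha> j / 2"
    using hkz_size_reduce[OF hkz v] by blast
  define X where "X = {x \<in> Zn n. x \<notin> intspan k b \<and> (\<forall>j<k. \<bar>B x (u j)\<bar> \<le> \<alpha> j / 2) \<and>
    dist2 k u x \<le> dist2 k u v0}"
  \<comment> \<open>\<open>R\<close> bounds the form on \<open>X\<close>: the part orthogonal to the
    \<open>u j\<close> is at most that of \<open>v0\<close>, and the coefficients are
    size-reduced.\<close>
  define R where "R = dist2 k u v0 + (\<Sum>j<k. (\<alpha> j / 2)\<^sup>2)"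
  have "X \<subseteq> {x \<in> Zn n. \<forall>i<n. \<bar>x i\<bar> \<le> sqrt (\<kappa> * R)}"
  proof safe
    fix x assume x: "x \<in> X"
    then show "x \<in> Zn n" by (simp add: X_def)
    fix i assume i: "i < n"
    have "(\<Sum>j<k. (B x (u j))\<^sup>2) \<le> (\<Sum>j<k. (\<alpha> j / 2)\<^sup>2)"
    proof (intro sum_mono)
      fix j assume "j \<in> {..<k}"
      then have "\<bar>B x (u j)\<bar> \<le> \<alpha> j / 2" using x by (auto simp: X_def)
      then show "(B x (u j))\<^sup>2 \<le> (\<alpha> j / 2)\<^sup>2" by (metis abs_ge_zero power2_abs power_mono)
    qed
    then have "B x x \<le> R" using x by (simp add: X_def R_def dist2_def)
    then have "\<kappa> * B x x \<le> \<kappa> * R" by (rule mult_left_mono[OF _ \<kappa>_nonneg])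
    then have "(x i)\<^sup>2 \<le> \<kappa> * R"
      using coordinate_le[of x i] i \<open>x \<in> Zn n\<close> by (auto simp: Zn_def)
    then show "\<bar>x i\<bar> \<le> sqrt (\<kappa> * R)" using real_sqrt_le_mono by fastforce
  qed
  then have "finite X" using finite_Zn_box finite_subset by blast
  moreover have "v0 \<in> X" using v0 by (simp add: X_def)
  ultimately obtain w where w: "w \<in> X" and w_min: "\<And>x. x \<in> X \<Longrightarrow> dist2 k u w \<le> dist2 k u x"
    using finite_has_minimal[of "dist2 k u ` X"]
    by (metis (no_types, lifting) arg_min_if_finite(1) arg_min_least empty_iff)
  have wZ: "w \<in> Zn n" and w_out: "w \<notin> intspan k b" using w by (auto simp: X_def)
  have min: "dist2 k u w \<le> dist2 k u x" if x: "x \<in> Zn n" "x \<notin> intspan k b" for x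
  proof -
    obtain x' where x': "x' \<in> Zn n" "x' \<notin> intspan k b" "dist2 k u x' = dist2 k u x"
      "\<forall>j<k. \<bar>B x' (u j)\<bar> \<le> \<alpha> j / 2"
      using hkz_size_reduce[OF hkz x] by blast
    show ?thesis
    proof (cases "dist2 k u x' \<le> dist2 k u v0")
      case True
      then have "x' \<in> X" using x' by (simp add: X_def)
      then show ?thesis using w_min x'(3) by metis
    next
      case False
      then show ?thesis using w_min[OF \<open>v0 \<in> X\<close>] x'(3) by simp
    qed
  qed
  \<comment> \<open>Distance zero would put \<open>w\<close> into the integer span by primitivity;
    so the rejection of \<open>w\<close> can be normalised.\<close>
  have pos: "dist2 k u w > 0"
    using hkz_intspan_if_dist2_zero[OF hkz wZ] w_out dist2_nonneg[OF u, of w] by fastforce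
  define a where "a = sqrt (dist2 k u w)"
  have a: "a > 0" "a\<^sup>2 = dist2 k u w" using pos by (auto simp: a_def)
  define e where "e = (\<lambda>t. (1 / a) * rej k u w t)"
  define b' u' \<alpha>' where "b' = b(k := w)" and "u' = u(k := e)" and "\<alpha>' = \<alpha>(k := a)"
  have eq: "b' i = b i" "u' i = u i" "\<alpha>' i = \<alpha> i" if "i < k" for i
    using that by (auto simp: b'_def u'_def \<alpha>'_def)
  have wR: "w \<in> Rn n" using wZ by (simp add: Zn_def)
  have e_left: "B e z = (1 / a) * B (rej k u w) z" for z
    unfolding e_def by (rule scale_left)
  have rw: "B (rej k u w) w = a\<^sup>2"
    unfolding a(2) by (simp add: rej_left proj_def lincomb_left dist2_def power2_eq_square sym[of "u _" w])
  have ee: "B e e = 1"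
    using a(1) rej_rej[OF u, of w] e_left[of e] e_left[of "rej k u w"] sym[of e "rej k u w"]
    by (simp add: a(2)[symmetric] power2_eq_square)
  have eu: "B e (u j) = 0" if "j < k" for j
    using rej_orthogonal[OF u that] by (simp add: e_left)
  have we: "B w e = a"
    using e_left[of w] rw a(1) by (simp add: sym[of w e] power2_eq_square)
  have eR: "e \<in> Rn n" using rej_in_Rn[OF u wR] by (auto simp: e_def Rn_iff)
  have on: "orthonormal (Suc k) u'"
    unfolding orthonormal_def
  proof (intro conjI allI impI)
    fix i assume i: "i < Suc k"
    then show "u' i \<in> Rn n" using u eR by (auto simp: orthonormal_def u'_def less_Suc_eq)
    fix j assume j: "j < Suc k"
    show "B (u' i) (u' j) = (if i = j then 1 else 0)"
    proof (cases "i < k"; cases "j < k")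
      assume "i < k" "j < k"
      then show ?thesis using u by (simp add: eq orthonormal_def)
    next
      assume "i < k" "\<not> j < k"
      then show ?thesis using j eu[of i] sym[of "u i" e] by (simp add: u'_def less_Suc_eq)
    next
      assume "\<not> i < k" "j < k"
      then show ?thesis using i eu[of j] by (simp add: u'_def less_Suc_eq)
    next
      assume "\<not> i < k" "\<not> j < k"
      then show ?thesis using i j ee by (simp add: u'_def less_Suc_eq)
    qed
  qed
  have we_proj: "w = proj (Suc k) u' w"
  proof
    fix t
    have "proj (Suc k) u' w t = proj k u' w t + B w (u' k) * u' k t"
      unfolding proj_def lincomb_Suc ..
    also have "proj k u' w = proj k u w" using eq(2) by (rule proj_cong)
    also have "u' k = e" by (simp add: u'_def)
    finally have "proj (Suc k) u' w t = proj k u w t + a * e t" by (simp only: we)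
    also have "\<dots> = w t" using a(1) by (simp add: e_def rej_def)
    finally show "w t = proj (Suc k) u' w t" by (simp only:)
  qed
  have size: "\<bar>B w (u j)\<bar> \<le> \<alpha> j / 2" if "j < k" for j
    using w that by (simp add: X_def)
  have "hkz (Suc k) b' u' \<alpha>'"
    unfolding hkz_def
  proof (rule conjI[OF on], intro allI impI)
    fix i assume "i < Suc k"
    then have "i < k \<or> i = k" by auto
    then show "b' i \<in> Zn n \<and> \<alpha>' i > 0 \<and> b' i = proj (Suc i) u' (b' i) \<and> B (b' i) (u' i) = \<alpha>' i \<and>
      (\<forall>j<i. \<bar>B (b' i) (u' j)\<bar> \<le> \<alpha>' j / 2) \<and>
      (\<forall>v\<in>Zn n. v \<notin> intspan i b' \<longrightarrow> (\<alpha>' i)\<^sup>2 \<le> dist2 i u' v)"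
    proof
      assume i: "i < k"
      have "proj (Suc i) u' = proj (Suc i) u" "dist2 i u' = dist2 i u" "intspan i b' = intspan i b"
        using i eq by (auto intro!: ext proj_cong dist2_cong intspan_cong fun_cong[OF proj_cong])
      then show ?thesis using hkz i eq unfolding hkz_def by simp
    next
      assume i: "i = k"
      have "dist2 k u' = dist2 k u" "intspan k b' = intspan k b"
        using eq by (auto intro!: ext dist2_cong intspan_cong)
      moreover have "b' k = w" "\<alpha>' k = a" "u' k = e" by (auto simp: b'_def \<alpha>'_def u'_def)
      ultimately show ?thesis
        unfolding i using wZ a min we size eq we_proj by simp
    qed
  qed
  then show ?thesis by blast
qed

text \<open>Otherwise the \<open>k + 1\<close> vectors \<open>coord_vec 0, ..., coord_vec k\<close>
  would all lie in the span of \<open>k\<close> vectors, and a relation between their coefficients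
  would be one between the vectors themselves.\<close>

lemma hkz_not_spanning:
  assumes hkz: "hkz k b u \<alpha>" and k: "k < n"
  shows "\<exists>v\<in>Zn n. v \<notin> intspan k b"
proof (rule ccontr)
  assume *: "\<not> ?thesis"
  have e: "coord_vec i = proj k u (coord_vec i)" if "i < n" for i
    using that * by (intro hkz_intspan_proj[OF hkz]) (auto simp: coord_vec_def Zn_iff)
  obtain c where c: "\<exists>i\<le>k. c i \<noteq> 0" "\<And>j. j < k \<Longrightarrow> (\<Sum>i\<le>k. c i * B (coord_vec i) (u j)) = 0"
    using more_vectors_than_coordinates_dependent[of k "\<lambda>i j. B (coord_vec i) (u j)"] by blast
  have "c m = 0" if m: "m \<le> k" for m
  proof -
    have "c m = (\<Sum>i\<le>k. if i = m then c m else 0)" using m by simp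
    also have "\<dots> = (\<Sum>i\<le>k. c i * coord_vec i m)" by (intro sum.cong) (auto simp: coord_vec_def)
    also have "\<dots> = (\<Sum>i\<le>k. \<Sum>j<k. c i * B (coord_vec i) (u j) * u j m)"
    proof (intro sum.cong refl)
      fix i assume "i \<in> {..k}"
      then have "coord_vec i m = (\<Sum>j<k. B (coord_vec i) (u j) * u j m)"
        using fun_cong[OF e[of i], of m] k by (simp add: proj_def lincomb_def)
      then show "c i * coord_vec i m = (\<Sum>j<k. c i * B (coord_vec i) (u j) * u j m)"
        by (simp add: sum_distrib_left mult.assoc)
    qed
    also have "\<dots> = (\<Sum>j<k. (\<Sum>i\<le>k. c i * B (coord_vec i) (u j)) * u j m)"
      by (subst sum.swap) (simp add: sum_distrib_right)
    also have "\<dots> = 0" using c(2) by simp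
    finally show ?thesis .
  qed
  then show False using c(1) by blast
qed

lemma hkz_exists: "k \<le> n \<Longrightarrow> \<exists>b u \<alpha>. hkz k b u \<alpha>"
proof (induction k)
  case 0
  then show ?case by (simp add: hkz_def orthonormal_def)
next
  case (Suc k)
  then obtain b u \<alpha> where "hkz k b u \<alpha>" by auto
  then show ?case
    using hkz_not_spanning hkz_extend Suc.prems by (metis Suc_le_lessD)
qed

lemma hkz_spanning:
  assumes "hkz n b u \<alpha>"
  shows "intspan n b = Zn n"
proof (rule antisym)
  show "intspan n b \<subseteq> Zn n" using assms by (intro intspan_subset_Zn) (auto simp: hkz_def)
  show "Zn n \<subseteq> intspan n b"
  proof
    fix v assume v: "v \<in> Zn n"
    \<comment> \<open>By Parseval nothing is left outside the span of \<open>n\<close> orthonormal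
      vectors, so primitivity applies.\<close>
    then have "dist2 n u v = 0"
      using parseval[of u v] assms by (auto simp: hkz_def Zn_def dist2_def)
    then show "v \<in> intspan n b" by (rule hkz_intspan_if_dist2_zero[OF assms v])
  qed
qed

lemma hkz_lattice_basis:
  assumes "hkz n b u \<alpha>"
  shows "lattice_basis n b"
  unfolding lattice_basis_def
proof (intro conjI)
  show "inj_on b {..<n}"
  proof (rule linorder_inj_onI)
    fix i j assume "i < j" "i \<in> {..<n}" "j \<in> {..<n}"
    then show "b i \<noteq> b j"
      using hkz_triangular[OF assms, of i j] assms by (auto simp: hkz_def)
  qed auto
  show "b ` {..<n} \<subseteq> Zn n" using assms by (auto simp: hkz_def)
  show "range (\<lambda>c j. \<Sum>i<n. real_of_int (c i) * b i j) = Zn n"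
    using hkz_spanning[OF assms] by (simp add: intspan_def lincomb_def)
qed

end

section \<open>Products of the Gram--Schmidt lengths\<close>

lemma dot_lincomb_right: "dot n x (lincomb k c f) = (\<Sum>i<k. c i * dot n x (f i))"
proof -
  have "dot n x (lincomb k c f) = (\<Sum>t<n. \<Sum>i<k. c i * (x t * f i t))"
    by (simp add: dot_def lincomb_def sum_distrib_left mult_ac)
  then show ?thesis
    by (simp add: sum.swap[of _ "{..<k}"] dot_def sum_distrib_left)
qed

lemma dot_diff_left: "dot n (\<lambda>t. x t - y t) z = dot n x z - dot n y z"
  by (simp add: dot_def left_diff_distrib sum_subtractf)

context positive_form
begin

lemma hkz_independent:
  assumes "hkz k b u \<alpha>" "lincomb k c b = (\<lambda>_. 0)" "i < k"
  shows "c i = 0"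
  using assms
proof (induction k)
  case (Suc k)
  have "0 = B (lincomb (Suc k) c b) (u k)" using Suc.prems zero_left by simp
  also have "\<dots> = c k * \<alpha> k"
    using hkz_triangular[OF Suc.prems(1), of _ k] Suc.prems(1) by (simp add: lincomb_left hkz_def)
  finally have ck: "c k = 0" using Suc.prems(1) by (auto simp: hkz_def)
  then have "lincomb k c b = (\<lambda>_. 0)" using Suc.prems(2) by (simp add: lincomb_Suc)
  then show ?case
    using Suc.IH hkz_mono[OF Suc.prems(1)] Suc.prems(3) ck by (auto simp: less_Suc_eq)
qed simp

lemma hkz_running_max_prod_le:
  fixes \<alpha> :: "nat \<Rightarrow> real"
  assumes hkz: "hkz n b u \<alpha>" and k: "k \<le> n" and n: "n \<ge> 1"
  shows "(\<Prod>i\<in>{k..<n}. Max (\<alpha> ` {k..i})) \<le> (\<Prod>i\<in>{k..<n}. sqrt n * \<alpha> i)"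
proof -
  define d where "d = n - k"
  \<comment> \<open>The form at \<open>u j\<close> involves only \<open>b j\<close> and the later
    basis vectors; reversing the indices makes it depend on earlier coordinates, as a triangular
    system requires.\<close>
  define \<rho> where "\<rho> i = n - Suc i" for i
  define M where "M i = Max (\<alpha> ` {k..i})" for i
  have \<rho>: "k \<le> \<rho> i" "\<rho> i < n" if "i < d" for i
    using that k by (auto simp: \<rho>_def d_def)
  have \<rho>_less: "\<rho> i' < \<rho> i" if "i < i'" "i' < d" for i i'
    using that k by (auto simp: \<rho>_def d_def)
  have \<rho>_inv: "n - Suc j < d" "\<rho> (n - Suc j) = j" if "k \<le> j" "j < n" for j
    using that by (auto simp: \<rho>_def d_def)
  have bij: "bij_betw \<rho> {..<d} {k..<n}"
    by (rule bij_betw_byWitness[of _ "\<lambda>j. n - Suc j"]) (use k in \<open>auto simp: \<rho>_def d_def\<close>)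
  have u: "orthonormal n u" using hkz by (simp add: hkz_def)
  have \<alpha>: "\<alpha> i > 0" "B (b i) (u i) = \<alpha> i" "b i \<in> Zn n" if "i < n" for i
    using hkz that by (auto simp: hkz_def)
  have M_ge: "\<alpha> j \<le> M i" if "k \<le> j" "j \<le> i" for i j
    unfolding M_def using that by (intro Max_ge) auto
  have M_pos: "M i > 0" if "k \<le> i" "i < n" for i
    using M_ge[of i i] \<alpha>(1)[of i] that by linarith
  have M_mono: "M i \<le> M j" if "k \<le> i" "i \<le> j" for i j
    unfolding M_def using that by (intro Max_mono) auto
  \<comment> \<open>Only combinations of \<open>b k, ..., b (n - 1)\<close> occur. Their coordinates
    below \<open>k\<close> are uncontrolled, which is harmless because the distances below are taken
    from spans of \<open>m \<ge> k\<close> vectors.\<close>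
  define v where "v c = lincomb d (\<lambda>i. of_int (c i)) (\<lambda>i. b (\<rho> i))" for c :: "nat \<Rightarrow> int"
  define l where "l c i = B (v c) (u (\<rho> i))" for c i
  define r where "r c i = (\<Sum>i'<i. of_int (c i') * B (b (\<rho> i')) (u (\<rho> i)))" for c :: "nat \<Rightarrow> int" and i
  define C where "C = {c. (\<forall>i\<ge>d. c i = 0) \<and> (\<forall>i<d. \<bar>l c i\<bar> < M (\<rho> i) / sqrt n)}"
  have tri: "l c i = \<alpha> (\<rho> i) * c i + r c i" if i: "i < d" for c i
  proof -
    have "l c i = (\<Sum>i'<d. of_int (c i') * B (b (\<rho> i')) (u (\<rho> i)))"
      by (simp add: l_def v_def lincomb_left)
    also have "\<dots> = (\<Sum>i'<Suc i. of_int (c i') * B (b (\<rho> i')) (u (\<rho> i)))"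
      using i hkz_triangular[OF hkz \<rho>_less] \<rho>(2)[OF i]
      by (intro sum.mono_neutral_right) (auto simp: not_less_eq)
    finally show ?thesis using \<alpha>(2)[OF \<rho>(2)[OF i]] by (simp add: r_def)
  qed
  have C0: "C \<subseteq> {\<lambda>_. 0}"
  proof
    fix c assume c: "c \<in> C"
    show "c \<in> {\<lambda>_. 0}"
    proof (rule ccontr)
      assume "\<not> ?thesis"
      then obtain i where "c i \<noteq> 0" by auto
      \<comment> \<open>In the original order this is the largest index \<open>j\<close> of a basis
        vector occurring in \<open>v c\<close>: the coordinates beyond \<open>j\<close> vanish, the
        one at \<open>j\<close> does not.\<close>
      define i0 where "i0 = (LEAST i. c i \<noteq> 0)"
      have ci0: "c i0 \<noteq> 0" unfolding i0_def by (rule LeastI[of _ i]) fact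
      have least: "c i = 0" if "i < i0" for i using not_less_Least that unfolding i0_def by blast
      have i0: "i0 < d" using c ci0 by (force simp: C_def not_le[symmetric])
      define j where "j = \<rho> i0"
      have j: "k \<le> j" "j < n" using \<rho>[OF i0] by (auto simp: j_def)
      have vZ: "v c \<in> Zn n" unfolding v_def using \<alpha>(3) \<rho> by (intro lincomb_in_Zn) auto
      have vj: "B (v c) (u j) \<noteq> 0"
      proof -
        have "r c i0 = 0" using least by (simp add: r_def)
        then show ?thesis using tri[OF i0, of c] ci0 \<alpha>(1)[OF j(2)] by (simp add: l_def j_def)
      qed
      have v0: "B (v c) (u m) = 0" if m: "j < m" "m < n" for m
      proof -
        have i: "n - Suc m < i0" using m \<rho>[OF i0] by (auto simp: j_def \<rho>_def)
        then have "l c (n - Suc m) = 0"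
          using tri[of "n - Suc m" c] i0 least by (simp add: r_def)
        then show ?thesis using \<rho>_inv(2)[of m] m j by (simp add: l_def)
      qed
      have vs: "\<bar>B (v c) (u m)\<bar> < M j / sqrt n" if m: "k \<le> m" "m \<le> j" for m
      proof -
        have mn: "m < n" using m j by simp
        have "\<bar>B (v c) (u m)\<bar> < M m / sqrt n"
          using c \<rho>_inv[OF m(1) mn] unfolding C_def l_def by fastforce
        also have "\<dots> \<le> M j / sqrt n" using M_mono[OF m] by (simp add: divide_right_mono)
        finally show ?thesis .
      qed
      \<comment> \<open>The minimality of \<open>\<alpha> m\<close>, for an \<open>m\<close>
        attaining the running maximum, applies to \<open>v c\<close>, whose nonzero coordinate at
        \<open>j \<ge> m\<close> keeps it out of \<open>intspan m b\<close>.\<close>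
      have "M j \<in> \<alpha> ` {k..j}" unfolding M_def using j by (intro Max_in) auto
      then obtain m where m: "k \<le> m" "m \<le> j" "\<alpha> m = M j" by auto
      have "v c \<notin> intspan m b"
        using hkz_intspan_orthogonal[OF hkz _ m(2) j(2)] vj by blast
      then have "(M j)\<^sup>2 \<le> dist2 m u (v c)"
        using hkz vZ m(3) le_less_trans[OF m(2) j(2)] unfolding hkz_def by metis
      also have "\<dots> = (\<Sum>i<n. (B (v c) (u i))\<^sup>2) - (\<Sum>i<m. (B (v c) (u i))\<^sup>2)"
        using parseval[OF u, of "v c"] vZ by (simp add: dist2_def Zn_def)
      also have "\<dots> = (\<Sum>i\<in>{..<n} - {..<m}. (B (v c) (u i))\<^sup>2)"
        using m j by (subst sum_diff) auto
      also have "\<dots> = (\<Sum>i\<in>{m..j}. (B (v c) (u i))\<^sup>2)"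
        using m j v0 by (intro sum.mono_neutral_right) auto
      \<comment> \<open>At most \<open>n\<close> coordinates remain, each with square below
        \<open>(M j)^2 / n\<close>, which contradicts the squared distance of at least
        \<open>(M j)^2\<close>.\<close>
      also have "\<dots> < (\<Sum>i\<in>{m..j}. (M j / sqrt n)\<^sup>2)"
      proof (rule sum_strict_mono)
        fix i assume "i \<in> {m..j}"
        then have "\<bar>B (v c) (u i)\<bar> < M j / sqrt n" using vs[of i] m by auto
        then show "(B (v c) (u i))\<^sup>2 < (M j / sqrt n)\<^sup>2"
          by (metis abs_ge_zero power2_abs power_strict_mono pos2)
      qed (use m in auto)
      also have "\<dots> = real (Suc j - m) * ((M j)\<^sup>2 / n)" by (simp add: power_divide)
      also have "\<dots> \<le> real n * ((M j)\<^sup>2 / n)"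
        using j by (intro mult_right_mono) auto
      finally show False using n by simp
    qed
  qed
  then have fin: "finite C" by (rule finite_subset) simp
  have "(\<Prod>i<d. M (\<rho> i) / sqrt n / \<alpha> (\<rho> i)) \<le> card C"
  proof (rule triangular_linear_forms[where l = l and r = r, OF tri _ _ _ _ C_def fin])
    show "r c i = r c' i" if "\<And>j. j < i \<Longrightarrow> c j = c' j" for c c' i
      using that by (simp add: r_def)
    show "l (\<lambda>j. c j - c' j) i = l c i - l c' i" for c c' i
      by (simp add: l_def v_def lincomb_left left_diff_distrib sum_subtractf)
  qed (use \<alpha> M_pos \<rho> n in auto)
  also have "real (card C) \<le> 1" using card_mono[OF _ C0] by simp
  also have "(\<Prod>i<d. M (\<rho> i) / sqrt n / \<alpha> (\<rho> i)) = (\<Prod>i\<in>{k..<n}. M i / sqrt n / \<alpha> i)"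
    by (rule prod.reindex_bij_betw[OF bij])
  also have "\<dots> = (\<Prod>i\<in>{k..<n}. M i) / (\<Prod>i\<in>{k..<n}. sqrt n * \<alpha> i)"
    by (simp add: prod_dividef prod.distrib)
  finally have "(\<Prod>i\<in>{k..<n}. M i) / (\<Prod>i\<in>{k..<n}. sqrt n * \<alpha> i) \<le> 1" .
  moreover have "(\<Prod>i\<in>{k..<n}. sqrt n * \<alpha> i) > 0"
    using \<alpha> n by (intro prod_pos) auto
  ultimately show ?thesis unfolding M_def by (simp add: divide_le_eq)
qed

text \<open>Since \<open>b m\<close> is a combination of \<open>u 0, ..., u m\<close> with leading
  coefficient \<open>\<alpha> m > 0\<close>, one can solve for \<open>u m\<close> recursively. This
  makes the dual system triangular.\<close>

lemma hkz_dot_determined: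
  fixes \<alpha> :: "nat \<Rightarrow> real"
  assumes hkz: "hkz n b u \<alpha>" and m: "m < n" and eq: "\<And>j. j \<le> m \<Longrightarrow> dot n x (b j) = dot n y (b j)"
  shows "dot n x (u m) = dot n y (u m)"
  using m eq
proof (induction m rule: less_induct)
  case (less m)
  have b: "b m = proj (Suc m) u (b m)" "B (b m) (u m) = \<alpha> m" "\<alpha> m > 0"
    using hkz less.prems(1) by (auto simp: hkz_def)
  have *: "dot n z (b m) = (\<Sum>j<m. B (b m) (u j) * dot n z (u j)) + \<alpha> m * dot n z (u m)" for z
    by (subst b(1)) (simp add: proj_def dot_lincomb_right b(2))
  have "dot n x (u j) = dot n y (u j)" if "j < m" for j
    using that less.prems by (intro less.IH) auto
  then have "(\<Sum>j<m. B (b m) (u j) * dot n x (u j)) = (\<Sum>j<m. B (b m) (u j) * dot n y (u j))"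
    by simp
  then show ?case
    using *[of x] *[of y] less.prems(2)[of m] b(3) by simp
qed

lemma hkz_dual_count:
  fixes \<alpha> :: "nat \<Rightarrow> real"
  assumes hkz: "hkz n b u \<alpha>" and k: "k \<le> n" and n: "n \<ge> 1"
    and X: "X = {x \<in> Zn n. \<forall>v\<in>Rn n. (dot n x v)\<^sup>2 \<le> B v v}" and finX: "finite X"
  shows "(\<Prod>i\<in>{k..<n}. \<alpha> i / sqrt n) \<le> card X"
proof -
  have u: "orthonormal n u" using hkz by (simp add: hkz_def)
  have \<alpha>: "\<alpha> i > 0" "B (b i) (u i) = \<alpha> i" "b i \<in> Zn n" "b i = proj (Suc i) u (b i)" if "i < n" for i
    using hkz that unfolding hkz_def by blast+
  \<comment> \<open>The integer coefficients of the unit vectors in the basis form the inverse of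
    the basis matrix.\<close>
  have "\<forall>j<n. \<exists>a :: nat \<Rightarrow> int. coord_vec j = lincomb n (\<lambda>i. of_int (a i)) b"
  proof (intro allI impI)
    fix j assume "j < n"
    then have "coord_vec j \<in> Zn n" by (auto simp: coord_vec_def Zn_iff)
    then show "\<exists>a :: nat \<Rightarrow> int. coord_vec j = lincomb n (\<lambda>i. of_int (a i)) b"
      unfolding hkz_spanning[OF hkz, symmetric] by (auto simp: intspan_def)
  qed
  then obtain a :: "nat \<Rightarrow> nat \<Rightarrow> int" where
    a: "\<And>j. j < n \<Longrightarrow> coord_vec j = lincomb n (\<lambda>i. of_int (a j i)) b" by metis
  \<comment> \<open>The integer point with coordinates \<open>e\<close> in the dual basis, that is,
    with product \<open>e m\<close> against \<open>b m\<close>.\<close>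
  define dual where "dual e = (\<lambda>j. if j < n then \<Sum>i<n. of_int (a j i) * of_int (e i) else 0 :: real)"
    for e :: "nat \<Rightarrow> int"
  have dual_Zn: "dual e \<in> Zn n" for e by (auto simp: dual_def Zn_iff)
  have inverse: "(\<Sum>j<n. b m j * of_int (a j i)) = (if i = m then 1 else 0)" if m: "m < n" and i: "i < n" for m i
  proof -
    define c where "c i = (\<Sum>j<n. b m j * of_int (a j i)) - (if i = m then 1 else 0)" for i
    have "lincomb n c b = (\<lambda>_. 0)"
    proof
      fix t
      have "b m t = (\<Sum>j<n. b m j * coord_vec j t)"
      proof (cases "t < n")
        case True
        have "(\<Sum>j<n. b m j * coord_vec j t) = (\<Sum>j<n. if j = t then b m t else 0)"
          by (intro sum.cong) (auto simp: coord_vec_def)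
        then show ?thesis using True by simp
      next
        case False
        then show ?thesis using \<alpha>(3)[OF m] by (auto simp: Zn_iff coord_vec_def intro!: sum.neutral)
      qed
      also have "\<dots> = (\<Sum>j<n. \<Sum>i<n. b m j * of_int (a j i) * b i t)"
        using a by (intro sum.cong) (auto simp: lincomb_def sum_distrib_left mult.assoc)
      also have "\<dots> = (\<Sum>i<n. (\<Sum>j<n. b m j * of_int (a j i)) * b i t)"
        by (subst sum.swap) (simp add: sum_distrib_right)
      finally have 1: "b m t = (\<Sum>i<n. (\<Sum>j<n. b m j * of_int (a j i)) * b i t)" .
      have "(\<Sum>i<n. (if i = m then 1 else 0) * b i t) = (\<Sum>i<n. if i = m then b m t else 0)"
        by (intro sum.cong) auto
      then have 2: "(\<Sum>i<n. (if i = m then 1 else 0) * b i t) = b m t" using m by simp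
      show "lincomb n c b t = 0"
        unfolding lincomb_def c_def left_diff_distrib sum_subtractf 1[symmetric] 2 by simp
    qed
    from hkz_independent[OF hkz this i] show ?thesis by (simp only: c_def right_minus_eq)
  qed
  have dual: "dot n (dual e) (b m) = of_int (e m)" if m: "m < n" for e m
  proof -
    have "dot n (dual e) (b m) = (\<Sum>j<n. \<Sum>i<n. b m j * of_int (a j i) * of_int (e i))"
      by (simp add: dot_def dual_def sum_distrib_right sum_distrib_left mult_ac)
    also have "\<dots> = (\<Sum>i<n. (\<Sum>j<n. b m j * of_int (a j i)) * of_int (e i))"
      by (subst sum.swap) (simp add: sum_distrib_right)
    also have "\<dots> = (\<Sum>i<n. if i = m then of_int (e m) else 0)"
      using inverse[OF m] by (intro sum.cong) auto
    finally show ?thesis using m by simp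
  qed
  define d where "d = n - k"
  \<comment> \<open>Zeros at the first \<open>k\<close> places make \<open>x c\<close> orthogonal to
    \<open>b 0, ..., b (k - 1)\<close> and hence to \<open>u 0, ..., u (k - 1)\<close>; only the
    last \<open>d\<close> forms have to be made small.\<close>
  define e :: "(nat \<Rightarrow> int) \<Rightarrow> nat \<Rightarrow> int" where "e c = (\<lambda>j. if j < k then 0 else c (j - k))" for c
  define x where "x c = dual (e c)" for c
  have x_diff: "x (\<lambda>j. c j - c' j) = (\<lambda>t. x c t - x c' t)" for c c'
    by (auto simp: x_def dual_def e_def fun_eq_iff sum_subtractf[symmetric] right_diff_distrib[symmetric]
        intro!: sum.cong)
  have x_zero: "dot n (x c) (u j) = 0" if j: "j < k" for c j
  proof -
    have "dot n (x c) (u j) = dot n (\<lambda>_. 0) (u j)"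
      using j k dual by (intro hkz_dot_determined[OF hkz]) (auto simp: x_def e_def dot_def[of n "\<lambda>_. 0"])
    then show ?thesis by (simp add: dot_def)
  qed
  define l where "l c i = dot n (x c) (u (k + i))" for c i
  \<comment> \<open>The expansion of \<open>b (k + i)\<close> is solved for its last Gram--Schmidt
    vector, which gives the diagonal entry \<open>1 / \<alpha> (k + i)\<close> and this
    remainder.\<close>
  define r where "r c i = - (\<Sum>t<k + i. B (b (k + i)) (u t) * dot n (x c) (u t)) / \<alpha> (k + i)" for c i
  define C where "C = {c. (\<forall>i\<ge>d. c i = 0) \<and> (\<forall>i<d. \<bar>l c i\<bar> < 1 / sqrt n)}"
  have tri: "l c i = 1 / \<alpha> (k + i) * c i + r c i" if "i < d" for c i
  proof -
    have i: "k + i < n" using that by (simp add: d_def)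
    have "of_int (c i) = dot n (x c) (b (k + i))"
      using dual[OF i] by (simp add: x_def e_def)
    also have "\<dots> = (\<Sum>t<k + i. B (b (k + i)) (u t) * dot n (x c) (u t)) + \<alpha> (k + i) * l c i"
      by (subst \<alpha>(4)[OF i]) (simp add: proj_def dot_lincomb_right \<alpha>(2)[OF i] l_def)
    finally show ?thesis using \<alpha>(1)[OF i] by (simp add: r_def field_simps)
  qed
  have x_in: "x c \<in> X" if c: "c \<in> C" for c
  proof -
    have small: "(dot n (x c) (u i))\<^sup>2 \<le> 1 / n" if i: "i < n" for i
    proof (cases "i < k")
      case False
      then have "\<bar>l c (i - k)\<bar> < 1 / sqrt n" using c i by (auto simp: C_def d_def)
      then have "\<bar>dot n (x c) (u i)\<bar> \<le> 1 / sqrt n" using False by (simp add: l_def)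
      then have "(dot n (x c) (u i))\<^sup>2 \<le> (1 / sqrt n)\<^sup>2"
        by (metis abs_ge_zero power2_abs power_mono)
      then show ?thesis by (simp add: power_divide)
    qed (simp add: x_zero)
    have "(dot n (x c) v)\<^sup>2 \<le> B v v" if v: "v \<in> Rn n" for v
    proof -
      \<comment> \<open>Cauchy--Schwarz in the coordinates of \<open>u\<close>: the \<open>n\<close>
        squares of the products of \<open>x c\<close> with the \<open>u i\<close> are at most
        \<open>1 / n\<close> each, so they sum to at most 1.\<close>
      have "(dot n (x c) v)\<^sup>2 = (\<Sum>i<n. B v (u i) * dot n (x c) (u i))\<^sup>2"
        by (subst orthonormal_complete[OF u v]) (simp add: proj_def dot_lincomb_right)
      also have "\<dots> \<le> (\<Sum>i<n. (B v (u i))\<^sup>2) * (\<Sum>i<n. (dot n (x c) (u i))\<^sup>2)"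
        by (rule Cauchy_Schwarz_ineq_sum)
      also have "\<dots> \<le> (\<Sum>i<n. (B v (u i))\<^sup>2) * (\<Sum>i<n. 1 / n)"
        using small by (intro mult_left_mono sum_mono sum_nonneg) auto
      also have "\<dots> = B v v" using n by (simp add: parseval[OF u v])
      finally show ?thesis .
    qed
    then show ?thesis using dual_Zn by (simp add: X x_def)
  qed
  have inj: "inj_on x C"
  proof (rule inj_onI)
    fix c c' assume c: "c \<in> C" "c' \<in> C" and eq: "x c = x c'"
    show "c = c'"
    proof
      fix i show "c i = c' i"
      proof (cases "i < d")
        case True
        then have "k + i < n" by (simp add: d_def)
        from dual[OF this, of "e c"] dual[OF this, of "e c'"] eq show ?thesis
          by (simp add: x_def e_def)
      qed (use c in \<open>simp add: C_def\<close>)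
    qed
  qed
  have sub: "x ` C \<subseteq> X" using x_in by blast
  have fin: "finite C" using inj_on_finite[OF inj sub finX] .
  have "(\<Prod>i<d. 1 / sqrt n / (1 / \<alpha> (k + i))) \<le> card C"
  proof (rule triangular_linear_forms[where l = l and r = r, OF tri _ _ _ _ C_def fin])
    show "r c i = r c' i" if i: "i < d" and eq: "\<And>j. j < i \<Longrightarrow> c j = c' j" for c c' i
    proof -
      have "dot n (x c) (u t) = dot n (x c') (u t)" if "t < k + i" for t
        using that i eq dual by (intro hkz_dot_determined[OF hkz]) (auto simp: x_def e_def d_def)
      then show ?thesis by (simp add: r_def)
    qed
    show "l (\<lambda>j. c j - c' j) i = l c i - l c' i" for c c' i
      by (simp add: l_def x_diff dot_diff_left)
  qed (use \<alpha> n in \<open>auto simp: d_def\<close>)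
  also have "card C \<le> card X" using card_inj_on_le[OF inj sub finX] .
  also have "(\<Prod>i<d. 1 / sqrt n / (1 / \<alpha> (k + i))) = (\<Prod>i\<in>{k..<n}. \<alpha> i / sqrt n)"
    by (rule prod.reindex_bij_witness[of _ "\<lambda>j. j - k" "\<lambda>i. k + i"]) (auto simp: d_def)
  finally show ?thesis by simp
qed

text \<open>By Parseval it suffices that each coefficient of \<open>b i\<close> is at most a
  Gram--Schmidt length of index up to \<open>i\<close>; size reduction gives this below
  \<open>i\<close>, and beyond \<open>i\<close> the coefficients vanish.\<close>

lemma hkz_norm_le:
  fixes \<alpha> :: "nat \<Rightarrow> real"
  assumes hkz: "hkz n b u \<alpha>" and i: "i < n"
  shows "B (b i) (b i) \<le> n * (Max (\<alpha> ` {..i}))\<^sup>2"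
proof -
  define m where "m = Max (\<alpha> ` {..i})"
  have \<alpha>: "0 < \<alpha> j" "\<alpha> j \<le> m" if "j \<le> i" for j
    using that hkz i by (auto simp: hkz_def m_def)
  have u: "orthonormal n u" using hkz by (simp add: hkz_def)
  have bi: "b i \<in> Rn n" using hkz i by (auto simp: hkz_def Zn_def)
  have "B (b i) (b i) = (\<Sum>j<n. (B (b i) (u j))\<^sup>2)" by (rule parseval[OF u bi])
  also have "\<dots> \<le> (\<Sum>j<n. m\<^sup>2)"
  proof (rule sum_mono)
    fix j assume "j \<in> {..<n}"
    have "\<bar>B (b i) (u j)\<bar> \<le> m"
    proof (cases "j \<le> i")
      case True
      then have "\<bar>B (b i) (u j)\<bar> \<le> \<alpha> j"
      proof (cases "j = i")
        case False
        with True have "\<bar>B (b i) (u j)\<bar> \<le> \<alpha> j / 2" using hkz i by (auto simp: hkz_def)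
        then show ?thesis using \<alpha>(1)[OF True] by simp
      next
        case [simp]: True
        have "B (b i) (u i) = \<alpha> i" using hkz i by (simp add: hkz_def)
        then show ?thesis using \<alpha>(1)[of i] by simp
      qed
      then show ?thesis using \<alpha>(2)[OF True] by simp
    next
      case False
      then have "B (b i) (u j) = 0" using hkz_triangular[OF hkz, of i j] \<open>j \<in> _\<close> by simp
      then show ?thesis using \<alpha>[of i] by simp
    qed
    then show "(B (b i) (u j))\<^sup>2 \<le> m\<^sup>2" by (metis abs_ge_zero power2_abs power_mono)
  qed
  finally show ?thesis by (simp add: m_def)
qed

end

section \<open>Integer points of symmetric convex bodies\<close>

lemma compact_if_convex_body:
  assumes "convex_body n K"
  shows "compact K" "K \<subseteq> Rn n"
proof -
  have "compactin (Euclidean_space n) K" using assms by (simp add: convex_body_def)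
  then show "compact K" "K \<subseteq> Rn n"
    using compactin_subset_topspace
    by (auto simp: Euclidean_space_def compactin_subtopology euclidean_product_topology)
qed

lemma half_diff_in_symmetric_convex_body:
  assumes K: "convex_body n K" "origin_symmetric K" and x: "x \<in> K" "y \<in> K"
  shows "(\<lambda>i. 1/2 * x i + 1/2 * - y i) \<in> K"
proof -
  have "(\<lambda>i. - y i) \<in> K" using x(2) K(2) unfolding origin_symmetric_def by blast
  moreover have "\<forall>x\<in>K. \<forall>y\<in>K. \<forall>u\<ge>0. \<forall>v\<ge>0. u + v = 1 \<longrightarrow> (\<lambda>i. u * x i + v * y i) \<in> K"
    using K(1) by (simp add: convex_body_def convex_fun_def)
  ultimately have "\<forall>u\<ge>0. \<forall>v\<ge>0. u + v = 1 \<longrightarrow> (\<lambda>i. u * x i + v * (- y i)) \<in> K"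
    using x(1) by fast
  from this[rule_format, of "1/2" "1/2"] show ?thesis by simp
qed

lemma zero_in_symmetric_convex_body:
  assumes "convex_body n K" "origin_symmetric K" "K \<noteq> {}"
  shows "(\<lambda>_. 0) \<in> K"
proof -
  obtain x where x: "x \<in> K" using assms(3) by blast
  from half_diff_in_symmetric_convex_body[OF assms(1,2) this this] show ?thesis by simp
qed

text \<open>The separating direction points from the nearest point \<open>y0\<close> of
  \<open>K\<close> towards \<open>x\<close>.\<close>

lemma separation_from_convex_body:
  assumes K: "convex_body n K" "K \<noteq> {}" and x: "x \<in> Rn n" "x \<notin> K"
  shows "\<exists>v\<in>Rn n. \<forall>y\<in>K. dot n y v < dot n x v"
proof -
  define f where "f y = (\<Sum>i<n. (y i - x i)\<^sup>2)" for y
  have "continuous_on K f"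
    unfolding f_def by (intro continuous_intros continuous_on_eval)
  then obtain y0 where y0: "y0 \<in> K" and min: "\<And>y. y \<in> K \<Longrightarrow> f y0 \<le> f y"
    using continuous_attains_inf[OF compact_if_convex_body(1)[OF K(1)] K(2)] by blast
  define v where "v = (\<lambda>i. x i - y0 i)"
  have y0R: "y0 \<in> Rn n" using compact_if_convex_body(2)[OF K(1)] y0 by blast
  have vR: "v \<in> Rn n" using x y0R by (simp add: v_def Rn_iff)
  have "x \<noteq> y0" using x y0 by blast
  then have "v \<noteq> (\<lambda>_. 0)" by (auto simp: v_def fun_eq_iff)
  then obtain i where "v i \<noteq> 0" "i < n" using vR by (auto simp: Rn_iff fun_eq_iff not_le[symmetric])
  then have vv: "dot n v v > 0"
    unfolding dot_def by (intro sum_pos2[of _ i]) (auto simp: zero_less_mult_iff)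
  have xv: "dot n x v = dot n y0 v + dot n v v"
    by (simp add: v_def dot_def sum.distrib[symmetric] algebra_simps)
  have "dot n y v < dot n x v" if y: "y \<in> K" for y
  proof -
    define D E where "D = dot n (\<lambda>i. y i - y0 i) v" and "E = (\<Sum>i<n. (y i - y0 i)\<^sup>2)"
    \<comment> \<open>\<open>y0\<close> is compared with the point at parameter \<open>u\<close> on
      the segment from \<open>y0\<close> to \<open>y\<close>.\<close>
    have le: "2 * D \<le> u * E" if u: "0 < u" "u \<le> 1" for u
    proof -
      have "(\<lambda>i. (1 - u) * y0 i + u * y i) \<in> K"
        using K(1) y y0 u unfolding convex_body_def convex_fun_def by auto
      from min[OF this] have "f y0 \<le> f (\<lambda>i. (1 - u) * y0 i + u * y i)" .
      also have "\<dots> = (\<Sum>i<n. (y0 i - x i)\<^sup>2 - 2 * u * ((y i - y0 i) * v i) + u\<^sup>2 * (y i - y0 i)\<^sup>2)"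
        unfolding f_def v_def by (intro sum.cong) (auto simp: power2_eq_square algebra_simps)
      also have "\<dots> = f y0 - 2 * u * D + u\<^sup>2 * E"
        by (simp add: f_def D_def E_def dot_def sum.distrib sum_subtractf sum_distrib_left)
      finally have "u * (2 * D) \<le> u * (u * E)" by (simp add: power2_eq_square algebra_simps)
      then show ?thesis using u by simp
    qed
    have "D \<le> 0"
    proof (rule ccontr)
      assume "\<not> D \<le> 0"
      then have D: "D > 0" by simp
      have E: "E \<ge> 2 * D" using le[of 1] by simp
      \<comment> \<open>The choice \<open>u = D / E\<close> would give
        \<open>2 * D \<le> D\<close>.\<close>
      then have "D / E * E = D" "0 < D / E" "D / E \<le> 1" using D by auto
      then show False using le[of "D / E"] D by simp
    qed
    then have "dot n y v \<le> dot n y0 v" by (simp add: D_def dot_diff_left)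
    then show ?thesis using xv vv by simp
  qed
  then show ?thesis using vR by blast
qed

lemma convex_body_bounded:
  assumes "convex_body n K"
  shows "\<exists>R\<ge>1. \<forall>x\<in>K. \<forall>i<n. \<bar>x i\<bar> \<le> R"
proof -
  have "\<exists>R. \<forall>x\<in>K. \<bar>x i\<bar> \<le> R" for i
  proof -
    have "compact ((\<lambda>x. x i) ` K)"
      using compact_if_convex_body(1)[OF assms] by (intro compact_continuous_image continuous_on_eval)
    then have "bounded ((\<lambda>x. x i) ` K)" by (rule compact_imp_bounded)
    then show ?thesis by (auto simp: bounded_iff)
  qed
  then obtain R where R: "\<And>x i. x \<in> K \<Longrightarrow> \<bar>x i\<bar> \<le> R i" by metis
  show ?thesis
  \<comment> \<open>The summand 1 ensures \<open>R \<ge> 1\<close>, so that the box also holds the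
    points \<open>\<epsilon> e_i\<close> of \<open>lattice_john_form\<close>.\<close>
  proof (intro exI[of _ "1 + (\<Sum>i<n. \<bar>R i\<bar>)"] conjI ballI allI impI)
    fix x i assume "x \<in> K" "i < n"
    have "\<bar>x i\<bar> \<le> R i" by (rule R) fact
    also have "\<dots> \<le> \<bar>R i\<bar>" by simp
    also have "\<dots> \<le> (\<Sum>i<n. \<bar>R i\<bar>)" using \<open>i < n\<close> by (intro member_le_sum) auto
    finally show "\<bar>x i\<bar> \<le> 1 + (\<Sum>i<n. \<bar>R i\<bar>)" by simp
  qed (simp add: sum_nonneg)
qed

lemma finite_lattice_points:
  assumes "convex_body n K"
  shows "finite (K \<inter> Zn n)"
proof -
  obtain R where "\<forall>x\<in>K. \<forall>i<n. \<bar>x i\<bar> \<le> R" using convex_body_bounded[OF assms] by blast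
  then have "K \<inter> Zn n \<subseteq> {x \<in> Zn n. \<forall>i<n. \<bar>x i\<bar> \<le> R}" by blast
  then show ?thesis using finite_Zn_box finite_subset by blast
qed

section \<open>The quadratic form attached to the integer points\<close>

lemma dot_commute: "dot n x y = dot n y x"
  by (simp add: dot_def mult.commute)

lemma dot_coord_vec:
  assumes "i < n"
  shows "dot n x (coord_vec i) = x i" "dot n (coord_vec i) x = x i"
proof -
  have "dot n x (coord_vec i) = (\<Sum>j<n. if j = i then x i else 0)"
    unfolding dot_def by (intro sum.cong) (auto simp: coord_vec_def)
  then show "dot n x (coord_vec i) = x i" using assms by simp
  then show "dot n (coord_vec i) x = x i" by (simp add: dot_commute)
qed

lemma dot_scale_left: "dot n (\<lambda>t. c * x t) y = c * dot n x y"
  by (simp add: dot_def sum_distrib_left mult.assoc)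

lemma dot_uminus_left: "dot n (\<lambda>t. - x t) y = - dot n x y"
  by (simp add: dot_def sum_negf)

lemma dot_add_right: "dot n x (\<lambda>t. y t + z t) = dot n x y + dot n x z"
  by (simp add: dot_def distrib_left sum.distrib)

lemma dot_scale_right: "dot n x (\<lambda>t. c * y t) = c * dot n x y"
  by (simp add: dot_def sum_distrib_left mult_ac)

text \<open>
  John's theorem for the integer points of \<open>K\<close>. The points \<open>\<epsilon> e\<^sub>i\<close> are added so that the form is
  definite even when the integer points do not span; since only finitely many integer points have
  to be kept outside of the resulting ellipsoid, this does no harm for small \<open>\<epsilon>\<close>.
\<close>

lemma lattice_john_form:
  assumes n: "n \<ge> 1" and K: "convex_body n K" "origin_symmetric K" "K \<noteq> {}"
  shows "\<exists>B \<kappa>. positive_form n B \<kappa> \<and> (\<forall>s\<in>K \<inter> Zn n. \<forall>v. (dot n s v)\<^sup>2 \<le> n * B v v) \<and>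
    (\<forall>x\<in>Zn n. (\<forall>v\<in>Rn n. (dot n x v)\<^sup>2 \<le> B v v) \<longrightarrow> x \<in> K)"
proof -
  obtain R where R: "R \<ge> 1" "\<And>x i. x \<in> K \<Longrightarrow> i < n \<Longrightarrow> \<bar>x i\<bar> \<le> R"
    using convex_body_bounded[OF K(1)] by blast
  have zero: "(\<lambda>_. 0) \<in> K" by (rule zero_in_symmetric_convex_body[OF K])
  \<comment> \<open>Integer points outside the box will violate the ellipsoid condition at a unit
    vector, so only these finitely many need a separating functional.\<close>
  define bad where "bad = {x \<in> Zn n. \<forall>i<n. \<bar>x i\<bar> \<le> R} - K"
  have fin_bad: "finite bad" unfolding bad_def using finite_Zn_box by blast
  have "\<forall>x\<in>bad. \<exists>v\<in>Rn n. \<forall>y\<in>K. dot n y v < dot n x v"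
    using separation_from_convex_body[OF K(1) K(3)] by (auto simp: bad_def Zn_def)
  then obtain f where f: "\<And>x. x \<in> bad \<Longrightarrow> f x \<in> Rn n"
    "\<And>x y. x \<in> bad \<Longrightarrow> y \<in> K \<Longrightarrow> dot n y (f x) < dot n x (f x)" by metis
  \<comment> \<open>For small \<open>\<epsilon>\<close> each functional separates its bad point from
    the vectors \<open>\<epsilon> e_i\<close> and \<open>- \<epsilon> e_i\<close> as well.\<close>
  have "\<forall>\<^sub>F \<epsilon> in at_right 0. \<forall>x\<in>bad. \<forall>i\<in>{..<n}. \<epsilon> * \<bar>f x i\<bar> < dot n x (f x)"
  proof (intro eventually_ball_finite ballI fin_bad)
    fix x i assume x: "x \<in> bad"
    have "((\<lambda>\<epsilon>. \<epsilon> * \<bar>f x i\<bar>) \<longlongrightarrow> 0 * \<bar>f x i\<bar>) (at_right 0)"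
      by (intro tendsto_intros)
    moreover have "0 < dot n x (f x)" using f(2)[OF x zero] by (simp add: dot_def)
    ultimately show "\<forall>\<^sub>F \<epsilon> in at_right 0. \<epsilon> * \<bar>f x i\<bar> < dot n x (f x)"
      by (intro order_tendstoD(2)) auto
  qed simp
  moreover have "\<forall>\<^sub>F \<epsilon>::real in at_right 0. 0 < \<epsilon> \<and> \<epsilon> < 1"
    using eventually_at_right_real[of 0 1] by simp
  ultimately have ev: "\<forall>\<^sub>F \<epsilon>::real in at_right 0. (0 < \<epsilon> \<and> \<epsilon> < 1) \<and>
      (\<forall>x\<in>bad. \<forall>i\<in>{..<n}. \<epsilon> * \<bar>f x i\<bar> < dot n x (f x))"
    by eventually_elim auto
  have "\<exists>\<epsilon>::real. (0 < \<epsilon> \<and> \<epsilon> < 1) \<and>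
      (\<forall>x\<in>bad. \<forall>i\<in>{..<n}. \<epsilon> * \<bar>f x i\<bar> < dot n x (f x))"
    by (rule eventually_happens'[OF _ ev]) simp
  then obtain \<epsilon> :: real where \<epsilon>: "0 < \<epsilon>" "\<epsilon> < 1"
    "\<And>x i. x \<in> bad \<Longrightarrow> i < n \<Longrightarrow> \<epsilon> * \<bar>f x i\<bar> < dot n x (f x)"
    by blast
  define T where "T = (\<lambda>i t. \<epsilon> * coord_vec i t) ` {..<n}"
  define S where "S = K \<inter> Zn n \<union> T"
  have finS: "finite S" using finite_lattice_points[OF K(1)] by (simp add: S_def T_def)
  have dotT: "dot n (\<lambda>t. \<epsilon> * coord_vec i t) v = \<epsilon> * v i" if "i < n" for i v
    using that by (simp add: dot_scale_left dot_coord_vec)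
  have "\<exists>p. (\<forall>s\<in>S. 0 \<le> p s) \<and> sum p S = 1 \<and>
    (\<forall>s\<in>S. \<forall>b. (dot n s b)\<^sup>2 \<le> n * (\<Sum>r\<in>S. p r * (dot n r b)\<^sup>2))"
  proof (rule D_optimal_design[OF n finS])
    fix w assume w: "\<And>s. s \<in> S \<Longrightarrow> dot n s w = 0"
    show "\<forall>i<n. w i = 0"
    proof (intro allI impI)
      fix i assume i: "i < n"
      then have "(\<lambda>t. \<epsilon> * coord_vec i t) \<in> S" by (auto simp: S_def T_def)
      from w[OF this] show "w i = 0" using dotT[OF i] \<epsilon>(1) by simp
    qed
  qed
  then obtain p where p: "\<And>s. s \<in> S \<Longrightarrow> 0 \<le> p s" "sum p S = 1"
    "\<And>s b. s \<in> S \<Longrightarrow> (dot n s b)\<^sup>2 \<le> n * (\<Sum>r\<in>S. p r * (dot n r b)\<^sup>2)" by blast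
  define B where "B x y = (\<Sum>s\<in>S. p s * (dot n s x * dot n s y))" for x y
  have Bvv: "B v v = (\<Sum>s\<in>S. p s * (dot n s v)\<^sup>2)" for v
    by (simp add: B_def power2_eq_square)
  \<comment> \<open>The constant \<open>n / \<epsilon>^2\<close> comes from the design inequality at
    the point \<open>\<epsilon> e_i\<close> of \<open>S\<close>.\<close>
  have form: "positive_form n B (n / \<epsilon>\<^sup>2)"
  proof
    show "B x y = B y x" for x y by (simp add: B_def mult.commute)
    show "B (\<lambda>t. x t + y t) z = B x z + B y z" for x y z
      by (simp add: B_def dot_add_right distrib_left distrib_right sum.distrib)
    show "B (\<lambda>t. c * x t) z = c * B x z" for c x z
      by (simp add: B_def dot_scale_right sum_distrib_left mult_ac)
    show "0 \<le> B x x" for x unfolding Bvv using p(1) by (intro sum_nonneg) auto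
    show "0 \<le> n / \<epsilon>\<^sup>2" by simp
    show "(x i)\<^sup>2 \<le> n / \<epsilon>\<^sup>2 * B x x" if i: "i < n" for x i
    proof -
      have "(\<lambda>t. \<epsilon> * coord_vec i t) \<in> S" using i by (auto simp: S_def T_def)
      from p(3)[OF this, of x] have "\<epsilon>\<^sup>2 * (x i)\<^sup>2 \<le> n * B x x"
        unfolding dotT[OF i] Bvv by (simp add: power_mult_distrib)
      then show ?thesis using \<epsilon>(1) by (simp add: field_simps)
    qed
  qed
  have "(dot n s v)\<^sup>2 \<le> n * B v v" if "s \<in> K \<inter> Zn n" for s v
    using p(3)[of s v] that by (simp add: S_def Bvv)
  moreover have "x \<in> K" if x: "x \<in> Zn n" "\<forall>v\<in>Rn n. (dot n x v)\<^sup>2 \<le> B v v" for x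
  proof (rule ccontr)
    assume "x \<notin> K"
    have "\<bar>x i\<bar> \<le> R" if i: "i < n" for i
    proof -
      have "coord_vec i \<in> Rn n" using i by (auto simp: Rn_iff coord_vec_def)
      then have "(x i)\<^sup>2 \<le> B (coord_vec i) (coord_vec i)"
        using x(2) dot_coord_vec(1)[OF i, of x] by metis
      also have "\<dots> \<le> (\<Sum>s\<in>S. p s * R\<^sup>2)"
        unfolding Bvv
      proof (intro sum_mono mult_left_mono p(1))
        fix s assume "s \<in> S"
        then have "\<bar>s i\<bar> \<le> R"
          using R(2)[of s i] i R(1) \<epsilon> by (auto simp: S_def T_def coord_vec_def)
        then show "(dot n s (coord_vec i))\<^sup>2 \<le> R\<^sup>2"
          unfolding dot_coord_vec(1)[OF i] by (metis abs_ge_zero power2_abs power_mono)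
      qed
      also have "\<dots> = R\<^sup>2" by (simp add: sum_distrib_right[symmetric] p(2))
      finally show ?thesis using R(1) by (simp add: abs_le_square_iff[symmetric])
    qed
    with x \<open>x \<notin> K\<close> have bad: "x \<in> bad" by (simp add: bad_def)
    define D where "D = dot n x (f x)"
    have less: "\<bar>dot n s (f x)\<bar> < D" if s: "s \<in> S" for s
    proof (cases "s \<in> K")
      case True
      then have "(\<lambda>i. - s i) \<in> K" using K(2) unfolding origin_symmetric_def by blast
      then show ?thesis
        using f(2)[OF bad True] f(2)[OF bad, of "\<lambda>i. - s i"] by (auto simp: D_def dot_uminus_left)
    next
      case False
      then obtain i where "i < n" "s = (\<lambda>t. \<epsilon> * coord_vec i t)"
        using s by (auto simp: S_def T_def)
      then show ?thesis
        using \<epsilon>(3)[OF bad, of i] \<epsilon>(1) by (simp add: dotT D_def abs_mult)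
    qed
    \<comment> \<open>A point of positive weight keeps the inequality strict when the bounds are
      averaged over the design.\<close>
    have "\<exists>s\<in>S. p s > 0"
      using p(1,2) by (metis le_less sum.neutral zero_neq_one)
    then obtain s where s: "s \<in> S" "p s > 0" by blast
    have sq: "(dot n s (f x))\<^sup>2 < D\<^sup>2" if "s \<in> S" for s
      using less[OF that] by (metis abs_ge_zero power2_abs power_strict_mono pos2)
    have "0 < (\<Sum>s\<in>S. p s * (D\<^sup>2 - (dot n s (f x))\<^sup>2))"
      using s sq p(1) by (intro sum_pos2[OF finS s(1)] mult_pos_pos mult_nonneg_nonneg) (auto simp: less_imp_le)
    also have "\<dots> = D\<^sup>2 - B (f x) (f x)"
      by (simp add: right_diff_distrib sum_subtractf Bvv sum_distrib_right[symmetric] p(2))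
    finally show False using x(2) f(1)[OF bad] by (auto simp: D_def)
  qed
  ultimately show ?thesis using form by blast
qed

text \<open>Pigeonhole over the integers from \<open>- \<lfloor>r\<rfloor>\<close> to
  \<open>\<lfloor>r\<rfloor>\<close>. Taking \<open>t\<close> in \<open>S\<close> provides an
  integer translation vector and a slice that is not empty.\<close>

lemma large_slice_exists:
  assumes S: "finite S" "S \<noteq> {}" "S \<subseteq> Zn n" and b: "b \<in> Zn n"
    and le: "\<And>s. s \<in> S \<Longrightarrow> \<bar>dot n s b\<bar> \<le> r"
  shows "\<exists>t\<in>S. card S \<le> card {s \<in> S. dot n s b = dot n t b} * nat (2 * \<lfloor>r\<rfloor> + 1)"
proof -
  have int: "dot n s b \<in> \<int>" if "s \<in> S" for s
    using that S b by (auto simp: dot_def Zn_iff intro!: Ints_sum Ints_mult)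
  define f where "f s = \<lfloor>dot n s b\<rfloor>" for s
  have f: "dot n s b = f s" if "s \<in> S" for s
    using int[OF that] by (auto simp: f_def elim: Ints_cases)
  obtain s0 where s0: "s0 \<in> S" using S by blast
  have r: "r \<ge> 0" using le[OF s0] by linarith
  have "f \<in> S \<rightarrow> {- \<lfloor>r\<rfloor>..\<lfloor>r\<rfloor>}"
  proof
    fix s assume "s \<in> S"
    then have "\<bar>real_of_int (f s)\<bar> \<le> r" using le f by metis
    then show "f s \<in> {- \<lfloor>r\<rfloor>..\<lfloor>r\<rfloor>}" by simp linarith
  qed
  then have "\<exists>y\<in>{- \<lfloor>r\<rfloor>..\<lfloor>r\<rfloor>}. card (f -` {y} \<inter> S) * card {- \<lfloor>r\<rfloor>..\<lfloor>r\<rfloor>} \<ge> card S"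
    using S r by (intro pigeonhole_card) auto
  then obtain y where y: "card S \<le> card (f -` {y} \<inter> S) * nat (2 * \<lfloor>r\<rfloor> + 1)"
    by (auto simp: algebra_simps)
  moreover have "card S > 0" using S by (simp add: card_gt_0_iff)
  ultimately have "f -` {y} \<inter> S \<noteq> {}" by auto
  then obtain t where t: "t \<in> S" "f t = y" by auto
  have "f -` {y} \<inter> S = {s \<in> S. dot n s b = dot n t b}" using t f by auto
  then show ?thesis using y t by metis
qed

text \<open>
  Two points of a slice that agree modulo 2 have half their difference in the central slice.
\<close>

lemma slice_le_central_slice:
  assumes K: "convex_body n K" "origin_symmetric K"
  shows "card {s \<in> K \<inter> Zn n. dot n s b = c} \<le> 2 ^ n * card {s \<in> K \<inter> Zn n. dot n s b = 0}"
proof -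
  define A where "A = {s \<in> K \<inter> Zn n. dot n s b = c}"
  define A0 where "A0 = {s \<in> K \<inter> Zn n. dot n s b = 0}"
  have fin: "finite A" "finite A0"
    unfolding A_def A0_def using finite_lattice_points[OF K(1)] by (rule rev_finite_subset; blast)+
  define par where "par s = (\<lambda>i\<in>{..<n}. even \<lfloor>s i\<rfloor>)" for s :: "nat \<Rightarrow> real"
  have "\<exists>y\<in>PiE {..<n} (\<lambda>_. UNIV :: bool set). card (par -` {y} \<inter> A) * card (PiE {..<n} (\<lambda>_. UNIV :: bool set)) \<ge> card A"
    using fin by (intro pigeonhole_card) (auto simp: par_def PiE_eq_empty_iff intro!: finite_PiE)
  then obtain y where y: "card A \<le> card (par -` {y} \<inter> A) * 2 ^ n" by (auto simp: card_PiE)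
  define G where "G = par -` {y} \<inter> A"
  have "card G \<le> card A0"
  proof (cases "G = {}")
    case False
    then obtain s0 where s0: "s0 \<in> G" by blast
    show ?thesis
    proof (rule card_inj_on_le[of "\<lambda>s i. 1/2 * s i + 1/2 * - s0 i"])
      show "inj_on (\<lambda>s i. 1/2 * s i + 1/2 * - s0 i) G"
        by (rule inj_onI) (auto simp: fun_eq_iff)
      show "(\<lambda>s i. 1/2 * s i + 1/2 * - s0 i) ` G \<subseteq> A0"
      proof (rule image_subsetI)
        fix s assume s: "s \<in> G"
        have sK: "s \<in> K" "s0 \<in> K" "s \<in> Zn n" "s0 \<in> Zn n" "dot n s b = c" "dot n s0 b = c"
          using s s0 by (auto simp: G_def A_def)
        let ?z = "\<lambda>i. 1/2 * s i + 1/2 * - s0 i"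
        have "?z \<in> K" by (rule half_diff_in_symmetric_convex_body[OF K sK(1,2)])
        moreover have "?z \<in> Zn n"
          unfolding Zn_iff
        proof (intro conjI allI impI)
          fix i
          show "?z i \<in> \<int>"
          proof (cases "i < n")
            case True
            have "par s i = par s0 i" using s s0 by (auto simp: G_def)
            then have "even \<lfloor>s i\<rfloor> = even \<lfloor>s0 i\<rfloor>" using True by (simp add: par_def)
            then have "even (\<lfloor>s i\<rfloor> - \<lfloor>s0 i\<rfloor>)" by simp
            then obtain z where z: "\<lfloor>s i\<rfloor> - \<lfloor>s0 i\<rfloor> = 2 * z" by (elim evenE)
            have "s i = \<lfloor>s i\<rfloor>" "s0 i = \<lfloor>s0 i\<rfloor>" using sK by (auto simp: Zn_iff)
            then have "?z i = 1/2 * of_int (\<lfloor>s i\<rfloor> - \<lfloor>s0 i\<rfloor>)"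
              by (simp add: diff_divide_distrib)
            then show ?thesis unfolding z by simp
          next
            case False
            then show ?thesis using sK by (simp add: Zn_iff)
          qed
        next
          fix i assume "n \<le> i"
          then show "?z i = 0" using sK by (simp add: Zn_iff)
        qed
        moreover have "dot n ?z b = 0"
        proof -
          have "dot n ?z b = 1/2 * dot n s b - 1/2 * dot n s0 b"
            by (simp add: dot_def sum_distrib_left sum_subtractf[symmetric] algebra_simps diff_divide_distrib)
          then show ?thesis using sK by simp
        qed
        ultimately show "?z \<in> A0" by (simp add: A0_def)
      qed
    qed (rule fin)
  qed simp
  then have "card A \<le> card A0 * 2 ^ n"
    using y unfolding G_def[symmetric] by (meson mult_le_mono1 order_trans)
  then show ?thesis by (simp add: A_def A0_def mult.commute)
qed

text \<open>Taking \<open>n\<close>-th roots keeps the weak inequality; the gap between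
  \<open>c\<close> and \<open>c'\<close> makes it strict.\<close>

lemma powr_root_less:
  fixes P c c' Q :: real
  assumes n: "n \<ge> 1" and pos: "P > 0" "c > 0" "Q > 0" and le: "P ^ (n - 1) \<le> c ^ n * Q" and "c < c'"
  shows "P powr ((real n - 1) / real n) < c' * Q powr (1 / real n)"
proof -
  have "P powr ((real n - 1) / real n) = (P ^ (n - 1)) powr (1 / real n)"
    using n pos by (simp add: powr_realpow[symmetric] powr_powr of_nat_diff)
  also have "\<dots> \<le> (c ^ n * Q) powr (1 / real n)"
    using le pos by (intro powr_mono2) auto
  also have "\<dots> = c * Q powr (1 / real n)"
    using n pos by (simp add: powr_mult powr_realpow[symmetric] powr_powr)
  also have "\<dots> < c' * Q powr (1 / real n)"
    using \<open>c < c'\<close> pos by (intro mult_strict_right_mono) auto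
  finally show ?thesis .
qed

section \<open>Widths along the reduced basis and the final count\<close>

lemma reduced_basis_widths:
  assumes n: "n \<ge> 1" and K: "convex_body n K" "origin_symmetric K" "K \<noteq> {}"
  shows "\<exists>b r. lattice_basis n b \<and> (\<forall>i<n. \<forall>s\<in>K \<inter> Zn n. \<bar>dot n s (b i)\<bar> \<le> r i) \<and>
    (\<Prod>i<n. real (nat (2 * \<lfloor>r i\<rfloor> + 1))) \<le> (3 * real n ^ 2) ^ n * card (K \<inter> Zn n)"
proof -
  obtain B :: "(nat \<Rightarrow> real) \<Rightarrow> (nat \<Rightarrow> real) \<Rightarrow> real" and \<kappa> :: real where form: "positive_form n B \<kappa>"
    and outer: "\<And>s v. s \<in> K \<inter> Zn n \<Longrightarrow> (dot n s v)\<^sup>2 \<le> n * B v v"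
    and inner: "\<And>x. x \<in> Zn n \<Longrightarrow> \<forall>v\<in>Rn n. (dot n x v)\<^sup>2 \<le> B v v \<Longrightarrow> x \<in> K"
    using lattice_john_form[OF n K] by blast
  interpret positive_form n B \<kappa> by (rule form)
  obtain b u \<alpha> where hkz: "hkz n b u \<alpha>" using hkz_exists by blast
  have \<alpha>: "\<alpha> i > 0" if "i < n" for i using hkz that by (simp add: hkz_def)
  define m where "m i = Max (\<alpha> ` {..i})" for i
  define r where "r i = n * m i" for i
  have m_ge: "\<alpha> j \<le> m i" if "j \<le> i" for i j
    unfolding m_def using that by (intro Max_ge) auto
  have m_pos: "m i > 0" if "i < n" for i
    using m_ge[of i i] \<alpha>[OF that] by linarith
  have m_mono: "m i \<le> m j" if "i \<le> j" for i j
    unfolding m_def using that by (intro Max_mono) auto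
  have le: "\<bar>dot n s (b i)\<bar> \<le> r i" if i: "i < n" and s: "s \<in> K \<inter> Zn n" for s i
  proof -
    have "(dot n s (b i))\<^sup>2 \<le> n * B (b i) (b i)" by (rule outer[OF s])
    also have "\<dots> \<le> n * (n * (m i)\<^sup>2)"
      using hkz_norm_le[OF hkz i] by (intro mult_left_mono) (auto simp: m_def)
    also have "\<dots> = (r i)\<^sup>2" by (simp add: r_def power2_eq_square)
    finally show ?thesis
      using m_pos[OF i] by (simp add: abs_le_square_iff[symmetric] r_def)
  qed
  \<comment> \<open>The \<open>r i\<close> never decrease, so \<open>k\<close> is the place where
    they reach 1; the alternative \<open>i = n\<close> covers the case that all stay below
    1.\<close>
  define k where "k = (LEAST i. i = n \<or> 1 \<le> r i)"
  have k: "k \<le> n" unfolding k_def by (rule Least_le) simp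
  have small: "r i < 1" if "i < k" for i
    using not_less_Least[of i "\<lambda>i. i = n \<or> 1 \<le> r i"] that by (auto simp: k_def)
  have "k = n \<or> 1 \<le> r k" unfolding k_def by (rule LeastI[of _ n]) simp
  then have large: "1 \<le> r i" if "k \<le> i" "i < n" for i
  proof -
    have "r k \<le> r i" unfolding r_def using m_mono[OF that(1)] by (rule mult_left_mono) simp
    moreover have "k \<noteq> n" using that by simp
    ultimately show ?thesis using \<open>k = n \<or> 1 \<le> r k\<close> by linarith
  qed
  \<comment> \<open>For \<open>j < k\<close> one has \<open>n * \<alpha> j < 1 \<le> r i\<close>, so
    the maximum is attained at an index from \<open>k\<close> on. This links the widths to the
    running maxima of the tail.\<close>
  have m_eq: "m i = Max (\<alpha> ` {k..i})" if i: "k \<le> i" "i < n" for i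
  proof (rule antisym)
    have "m i \<in> \<alpha> ` {..i}" unfolding m_def by (intro Max_in) auto
    then obtain j where j: "j \<le> i" "m i = \<alpha> j" by auto
    have "k \<le> j"
    proof (rule ccontr)
      assume "\<not> k \<le> j"
      then have "n * m j < 1" using small[of j] by (simp add: r_def)
      moreover have "real n * \<alpha> j \<le> n * m j" using m_ge[of j j] by (intro mult_left_mono) auto
      ultimately show False using large[OF i] j by (simp add: r_def)
    qed
    then show "m i \<le> Max (\<alpha> ` {k..i})" using j by (auto intro: Max_ge)
    show "Max (\<alpha> ` {k..i}) \<le> m i" unfolding m_def using i by (intro Max_mono) auto
  qed
  define X where "X = {x \<in> Zn n. \<forall>v\<in>Rn n. (dot n x v)\<^sup>2 \<le> B v v}"
  have X: "X \<subseteq> K \<inter> Zn n" using inner by (auto simp: X_def)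
  have fin: "finite (K \<inter> Zn n)" by (rule finite_lattice_points[OF K(1)])
  then have finX: "finite X" using X finite_subset by blast
  let ?N = "\<lambda>i. real (nat (2 * \<lfloor>r i\<rfloor> + 1))"
  have "(\<Prod>i<n. ?N i) = (\<Prod>i<k. ?N i) * (\<Prod>i\<in>{k..<n}. ?N i)"
    using k by (subst prod.union_disjoint[symmetric]) (auto simp: ivl_disj_un)
  also have "(\<Prod>i<k. ?N i) = 1"
  proof (rule prod.neutral, rule ballI)
    fix i assume "i \<in> {..<k}"
    then have "0 \<le> r i" "r i < 1" using small[of i] m_pos[of i] k by (auto simp: r_def)
    then have "\<lfloor>r i\<rfloor> = 0" by linarith
    then show "?N i = 1" by simp
  qed
  also have "1 * (\<Prod>i\<in>{k..<n}. ?N i) \<le> (\<Prod>i\<in>{k..<n}. 3 * real n * Max (\<alpha> ` {k..i}))"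
  proof (simp only: mult_1, intro prod_mono conjI)
    fix i assume "i \<in> {k..<n}"
    then have i: "k \<le> i" "i < n" by auto
    \<comment> \<open>Here \<open>r i \<ge> 1\<close> is decisive; this is the origin of the
      constant 3.\<close>
    have "?N i \<le> 3 * r i" using large[OF i] by linarith
    then show "?N i \<le> 3 * real n * Max (\<alpha> ` {k..i})"
      using m_eq[OF i] by (simp add: r_def)
  qed simp
  also have "\<dots> = (3 * real n) ^ (n - k) * (\<Prod>i\<in>{k..<n}. Max (\<alpha> ` {k..i}))"
    by (simp add: prod.distrib power_mult_distrib)
  also have "\<dots> \<le> (3 * real n) ^ (n - k) * (\<Prod>i\<in>{k..<n}. sqrt n * \<alpha> i)"
    by (intro mult_left_mono hkz_running_max_prod_le[OF hkz k n]) simp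
  \<comment> \<open>The factors are rewritten to match the dual count; the two losses of
    \<open>sqrt n\<close> combine to one more \<open>n\<close> per index.\<close>
  also have "(\<Prod>i\<in>{k..<n}. sqrt n * \<alpha> i) = (\<Prod>i\<in>{k..<n}. real n * (\<alpha> i / sqrt n))"
    using n by (intro prod.cong) (auto simp: field_simps)
  also have "\<dots> = real n ^ (n - k) * (\<Prod>i\<in>{k..<n}. \<alpha> i / sqrt n)"
    unfolding prod.distrib by simp
  also have "(3 * real n) ^ (n - k) * (real n ^ (n - k) * (\<Prod>i\<in>{k..<n}. \<alpha> i / sqrt n)) =
      (3 * real n ^ 2) ^ (n - k) * (\<Prod>i\<in>{k..<n}. \<alpha> i / sqrt n)"
    by (simp add: power_mult_distrib power2_eq_square)
  also have "\<dots> \<le> (3 * real n ^ 2) ^ (n - k) * card (K \<inter> Zn n)"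
  proof (intro mult_left_mono)
    have "(\<Prod>i\<in>{k..<n}. \<alpha> i / sqrt n) \<le> card X" by (rule hkz_dual_count[OF hkz k n X_def finX])
    also have "\<dots> \<le> card (K \<inter> Zn n)" using card_mono[OF fin X] by simp
    finally show "(\<Prod>i\<in>{k..<n}. \<alpha> i / sqrt n) \<le> card (K \<inter> Zn n)" .
  qed simp
  also have "\<dots> \<le> (3 * real n ^ 2) ^ n * card (K \<inter> Zn n)"
  proof (intro mult_right_mono power_increasing)
    have "1 \<le> real n ^ 2" using n by simp
    then show "1 \<le> 3 * real n ^ 2" by linarith
  qed auto
  finally show ?thesis
    using hkz_lattice_basis[OF hkz] le by (intro exI[of _ b] exI[of _ r]) auto
qed

lemma num_int_points_orth:
  "num_int_points n (K \<inter> orth n b) = card {s \<in> K \<inter> Zn n. dot n s b = 0}"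
  unfolding num_int_points_def by (rule arg_cong[of _ _ card]) (auto simp: orth_def dot_def Zn_def)

lemma num_int_points_translate_orth:
  assumes "t \<in> Zn n"
  shows "num_int_points n (K \<inter> translate t (orth n b)) = card {s \<in> K \<inter> Zn n. dot n s b = dot n t b}"
proof -
  have "x \<in> translate t (orth n b) \<longleftrightarrow> dot n x b = dot n t b" if "x \<in> Zn n" for x
  proof
    assume "x \<in> translate t (orth n b)"
    then show "dot n x b = dot n t b"
      by (auto simp: translate_def orth_def dot_def distrib_right sum.distrib)
  next
    assume eq: "dot n x b = dot n t b"
    have "(\<lambda>i. x i - t i) \<in> orth n b"
      using eq dot_diff_left[of n x t b] assms that by (simp add: orth_def dot_def Zn_iff Rn_iff)
    then show "x \<in> translate t (orth n b)"
      unfolding translate_def by (rule rev_image_eqI) auto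
  qed
  then show ?thesis
    unfolding num_int_points_def by (intro arg_cong[of _ _ card]) auto
qed

theorem theorem1p2:
  shows "\<exists>C::real. C > 0 \<and>
    (\<forall>(n::nat) (K :: (nat \<Rightarrow> real) set).
       n \<ge> 1 \<longrightarrow> convex_body n K \<longrightarrow> origin_symmetric K \<longrightarrow> K \<noteq> {} \<longrightarrow>
       (\<exists>b :: nat \<Rightarrow> nat \<Rightarrow> real. lattice_basis n b \<and>
          real (num_int_points n K) powr ((real n - 1) / real n)
            < C * real n ^ 2 * 2 ^ n *
              (\<Prod>i<n. real (num_int_points n (K \<inter> orth n (b i)))) powr (1 / real n) \<and>
          (\<exists>t :: nat \<Rightarrow> nat \<Rightarrow> real. (\<forall>i<n. t i \<in> Zn n) \<and>
             real (num_int_points n K) powr ((real n - 1) / real n)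
               < C * real n ^ 2 *
                 (\<Prod>i<n. real (num_int_points n (K \<inter> translate (t i) (orth n (b i)))))
                   powr (1 / real n))))"
proof (intro exI[of _ "4::real"] conjI allI impI)
  fix n :: nat and K :: "(nat \<Rightarrow> real) set"
  assume n: "n \<ge> 1" and K: "convex_body n K" "origin_symmetric K" "K \<noteq> {}"
  define S where "S = K \<inter> Zn n"
  have zero: "(\<lambda>_. 0) \<in> S"
    using zero_in_symmetric_convex_body[OF K] by (simp add: S_def Zn_iff)
  have S: "finite S" "S \<noteq> {}" "S \<subseteq> Zn n"
    using finite_lattice_points[OF K(1)] zero by (auto simp: S_def)
  obtain b and r :: "nat \<Rightarrow> real" where b: "lattice_basis n b"
    and r': "\<forall>i<n. \<forall>s\<in>S. \<bar>dot n s (b i)\<bar> \<le> r i"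
    and prod: "(\<Prod>i<n. real (nat (2 * \<lfloor>r i\<rfloor> + 1))) \<le> (3 * real n ^ 2) ^ n * card S"
    using reduced_basis_widths[OF n K, folded S_def] by blast
  then have r: "\<bar>dot n s (b i)\<bar> \<le> r i" if "i < n" "s \<in> S" for i s
    using that by blast
  have bZ: "b i \<in> Zn n" if "i < n" for i using b that by (auto simp: lattice_basis_def)
  have "\<forall>i. \<exists>t. i < n \<longrightarrow> t \<in> S \<and>
      card S \<le> card {s \<in> S. dot n s (b i) = dot n t (b i)} * nat (2 * \<lfloor>r i\<rfloor> + 1)"
    using large_slice_exists[OF S bZ r] by meson
  from choice[OF this] obtain t where t: "\<And>i. i < n \<Longrightarrow> t i \<in> S"
    "\<And>i. i < n \<Longrightarrow> card S \<le> card {s \<in> S. dot n s (b i) = dot n (t i) (b i)} * nat (2 * \<lfloor>r i\<rfloor> + 1)"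
    by blast
  define P where "P = real (card S)"
  define sl where "sl i = real (card {s \<in> S. dot n s (b i) = dot n (t i) (b i)})" for i
  define ce where "ce i = real (card {s \<in> S. dot n s (b i) = 0})" for i
  have P: "P > 0" using S by (simp add: P_def card_gt_0_iff)
  have sl_pos: "sl i > 0" if "i < n" for i
    using t(1)[OF that] S(1) by (auto simp: sl_def card_gt_0_iff)
  \<comment> \<open>The origin lies in every central slice.\<close>
  have ce_pos: "ce i > 0" for i
    using zero S(1) by (auto simp: ce_def card_gt_0_iff dot_def intro!: exI[of _ "\<lambda>_. 0"])
  have sl_ce: "sl i \<le> 2 ^ n * ce i" for i
    using slice_le_central_slice[OF K(1,2), where b = "b i" and c = "dot n (t i) (b i)"]
    unfolding sl_def ce_def S_def by (simp flip: of_nat_le_iff[where 'a = real])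
  \<comment> \<open>The \<open>n\<close> pigeonhole bounds are multiplied. One factor
    \<open>P\<close> cancels against the point count in the bound on the widths, which leaves the
    exponent \<open>n - 1\<close>.\<close>
  have "P ^ n = (\<Prod>i<n. P)" by simp
  also have "\<dots> \<le> (\<Prod>i<n. sl i * real (nat (2 * \<lfloor>r i\<rfloor> + 1)))"
  proof (intro prod_mono conjI)
    fix i assume "i \<in> {..<n}"
    then show "P \<le> sl i * real (nat (2 * \<lfloor>r i\<rfloor> + 1))"
      using t(2)[of i] unfolding P_def sl_def of_nat_mult[symmetric] of_nat_le_iff by simp
  qed (use P in simp)
  also have "\<dots> = (\<Prod>i<n. sl i) * (\<Prod>i<n. real (nat (2 * \<lfloor>r i\<rfloor> + 1)))" by (rule prod.distrib)
  also have "\<dots> \<le> (\<Prod>i<n. sl i) * ((3 * real n ^ 2) ^ n * P)"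
    using prod by (intro mult_left_mono prod_nonneg) (auto simp: P_def sl_def)
  finally have "P * P ^ (n - 1) \<le> P * ((3 * real n ^ 2) ^ n * (\<Prod>i<n. sl i))"
    using n by (simp add: power_eq_if mult_ac)
  then have slices: "P ^ (n - 1) \<le> (3 * real n ^ 2) ^ n * (\<Prod>i<n. sl i)" using P by simp
  \<comment> \<open>Each of the \<open>n\<close> slices costs \<open>2 ^ n\<close>, which is a
    single \<open>2 ^ n\<close> after the \<open>n\<close>-th root.\<close>
  also have "\<dots> \<le> (3 * real n ^ 2) ^ n * (\<Prod>i<n. 2 ^ n * ce i)"
    using sl_ce by (intro mult_left_mono prod_mono) (auto simp: sl_def)
  also have "\<dots> = (3 * real n ^ 2 * 2 ^ n) ^ n * (\<Prod>i<n. ce i)"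
    by (simp add: prod.distrib power_mult_distrib)
  finally have central: "P ^ (n - 1) \<le> (3 * real n ^ 2 * 2 ^ n) ^ n * (\<Prod>i<n. ce i)" .
  have pos: "(\<Prod>i<n. sl i) > 0" "(\<Prod>i<n. ce i) > 0"
    using sl_pos ce_pos by (auto intro: prod_pos)
  \<comment> \<open>Raising the constant from 3 to 4 makes both inequalities strict.\<close>
  have 1: "P powr ((real n - 1) / real n) < 4 * real n ^ 2 * (\<Prod>i<n. sl i) powr (1 / real n)"
    by (rule powr_root_less[OF n P _ pos(1) slices]) (use n in simp_all)
  have 2: "P powr ((real n - 1) / real n) < 4 * real n ^ 2 * 2 ^ n * (\<Prod>i<n. ce i) powr (1 / real n)"
    by (rule powr_root_less[OF n P _ pos(2) central]) (use n in simp_all)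
  have tZ: "\<forall>i<n. t i \<in> Zn n" using t(1) S(3) by blast
  have "(\<Prod>i<n. real (num_int_points n (K \<inter> translate (t i) (orth n (b i))))) = (\<Prod>i<n. sl i)"
    using tZ by (intro prod.cong) (auto simp: num_int_points_translate_orth sl_def S_def)
  moreover have "(\<Prod>i<n. real (num_int_points n (K \<inter> orth n (b i)))) = (\<Prod>i<n. ce i)"
    by (simp add: num_int_points_orth ce_def S_def)
  moreover have "real (num_int_points n K) = P" by (simp add: num_int_points_def P_def S_def)
  ultimately show "\<exists>b. lattice_basis n b \<and>
      real (num_int_points n K) powr ((real n - 1) / real n)
        < 4 * real n ^ 2 * 2 ^ n * (\<Prod>i<n. real (num_int_points n (K \<inter> orth n (b i)))) powr (1 / real n) \<and>
      (\<exists>t. (\<forall>i<n. t i \<in> Zn n) \<and>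
         real (num_int_points n K) powr ((real n - 1) / real n)
           < 4 * real n ^ 2 *
             (\<Prod>i<n. real (num_int_points n (K \<inter> translate (t i) (orth n (b i))))) powr (1 / real n))"
    using b tZ 1 2 by (intro exI[of _ b] conjI exI[of _ t]) simp_all
qed simp

end
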